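(* For every ordinary reduced polygon $V\subset\mathbb{H}^2$, $$\mathrm{diam}(V) < \operatorname{arccosh}\left(\cosh\Delta(V)\cdot\sqrt{1+\tfrac13\sinh^2\Delta(V)}\right).$$
   Context: A convex $k$-gon $V=v_1\dots v_k$ in $\mathbb{H}^2$ is the convex hull of $k\ge3$ points none in the convex hull of the others, listed in positive boundary order. For a line $H$ supporting a convex body $C$ (compact convex set with nonempty interior), $\mathrm{width}_H(C)$ is the distance between $H$ and a farthest line ultraparallel to $H$ supporting $C$; the thickness $\Delta(C)$ is the minimum of $\mathrm{width}_H(C)$ over supporting lines $H$. An ordinary reduced polygon is a convex $n$-gon $V=v_1\dots v_n$ with $n$ odd such that for every $i$ (indices modulo $n$), the orthogonal projection of $v_i$ onto the line $L_i$ containing the side $v_{i+(n-1)/2}v_{i+(n+1)/2}$ lies in the relative interior of that side, and the distance from $v_i$ to $L_i$ equals $\Delta(V)$. $\mathrm{diam}(V)$ is the maximal hyperbolic distance between two points of $V$. *)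

theory Defs
  imports "HOL-Analysis.Analysis"
begin

text \<open>Hyperbolic plane in the Beltrami--Klein model: the open Euclidean unit disk in
  the plane. Hyperbolic lines are the nonempty intersections of Euclidean lines with
  the disk, geodesic segments are Euclidean segments, and hyperbolically convex sets
  are exactly the Euclidean convex subsets of the disk.\<close>

type_synonym hpt = "real^2"

definition hpoint :: "hpt \<Rightarrow> bool" where
  "hpoint p \<longleftrightarrow> norm p < 1"

definition hdist :: "hpt \<Rightarrow> hpt \<Rightarrow> real" where
  "hdist p q = arcosh ((1 - p \<bullet> q) / sqrt ((1 - (norm p)^2) * (1 - (norm q)^2)))"

definition hline :: "hpt set \<Rightarrow> bool" where
  "hline H \<longleftrightarrow> (\<exists>u c. u \<noteq> 0 \<and> H = {p. hpoint p \<and> u \<bullet> p = c} \<and> H \<noteq> {})"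

definition hline_through :: "hpt \<Rightarrow> hpt \<Rightarrow> hpt set" where
  "hline_through a b = {p. hpoint p \<and> p \<in> affine hull {a, b}}"

definition hsetdist :: "hpt set \<Rightarrow> hpt set \<Rightarrow> real" where
  "hsetdist A B = Inf {hdist p q | p q. p \<in> A \<and> q \<in> B}"

definition ultraparallel :: "hpt set \<Rightarrow> hpt set \<Rightarrow> bool" where
  "ultraparallel H H' \<longleftrightarrow> hline H \<and> hline H' \<and> H \<inter> H' = {} \<and> hsetdist H H' > 0"

definition convex_body :: "hpt set \<Rightarrow> bool" where
  "convex_body C \<longleftrightarrow> (\<forall>p\<in>C. hpoint p) \<and> compact C \<and> convex C \<and> interior C \<noteq> {}"

definition supporting :: "hpt set \<Rightarrow> hpt set \<Rightarrow> bool" where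
  "supporting C H \<longleftrightarrow> (\<exists>u c. u \<noteq> 0 \<and> H = {p. hpoint p \<and> u \<bullet> p = c}
      \<and> (\<exists>p\<in>C. u \<bullet> p = c) \<and> (\<forall>p\<in>C. u \<bullet> p \<le> c))"

definition hwidth :: "hpt set \<Rightarrow> hpt set \<Rightarrow> real" where
  "hwidth H C = Sup {hsetdist H H' | H'. supporting C H' \<and> ultraparallel H H'}"

definition thickness :: "hpt set \<Rightarrow> real" where
  "thickness C = Inf {hwidth H C | H. supporting C H}"

definition hdiam :: "hpt set \<Rightarrow> real" where
  "hdiam C = Sup {hdist p q | p q. p \<in> C \<and> q \<in> C}"

definition cross2 :: "hpt \<Rightarrow> hpt \<Rightarrow> real" where
  "cross2 a b = a$1 * b$2 - a$2 * b$1"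

text \<open>Convex n-gon with vertices v 0, ..., v (n-1) (indices taken mod n),
  in convex position and listed in positive (counterclockwise) boundary order.\<close>
definition convex_polygon :: "nat \<Rightarrow> (nat \<Rightarrow> hpt) \<Rightarrow> bool" where
  "convex_polygon n v \<longleftrightarrow> n \<ge> 3 \<and> (\<forall>i<n. hpoint (v i))
     \<and> (\<forall>i<n. v i \<notin> convex hull (v ` ({..<n} - {i})))
     \<and> (\<forall>i<n. \<forall>j<n. j \<noteq> i \<and> j \<noteq> (i+1) mod n \<longrightarrow>
           cross2 (v ((i+1) mod n) - v i) (v j - v i) > 0)"

definition is_foot :: "hpt \<Rightarrow> hpt set \<Rightarrow> hpt \<Rightarrow> bool" where
  "is_foot p L q \<longleftrightarrow> q \<in> L \<and> (\<forall>r\<in>L. hdist p q \<le> hdist p r)"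

definition ordinary_reduced_polygon :: "nat \<Rightarrow> (nat \<Rightarrow> hpt) \<Rightarrow> bool" where
  "ordinary_reduced_polygon n v \<longleftrightarrow> odd n \<and> convex_polygon n v \<and>
     (\<forall>i<n. let a = v ((i + (n-1) div 2) mod n); b = v ((i + (n+1) div 2) mod n) in
        (\<exists>q. is_foot (v i) (hline_through a b) q \<and> q \<in> open_segment a b
             \<and> hdist (v i) q = thickness (convex hull (v ` {..<n}))))"

end

(* Points of the Klein disk are lifted to the hyperboloid in Minkowski space, where distances and
   perpendicularity become inner products.  Write n = 2h + 1 and let Delta be the common length of
   the heights.  Consecutive heights cut out congruent right triangles with hypotenuse a "long"
   diagonal and one leg Delta; adding up the other legs, the boundary arc from v_i to v_j
   (j - i <= h) is as long as the arc between the feet t_i and t_j of their heights.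

   The two heights cross at a point z under an angle whose cosine is -kappa; put a = |z v_i|,
   b = Delta - a, c = |z v_j|, e = Delta - c.  That v_j lies on the inner side of the side
   containing t_i (and conversely) bounds kappa from above and gives
     cosh^2 |v_i v_j| <= cosh^2 Delta cosh a cosh c / (cosh b cosh e).
   On the other hand |v_i v_j| is at most the arc from t_i to t_j, hence at most
   |t_i p| + |p t_j|, where p is the meeting point of the sides containing t_i and t_j (if there
   is one).  The two estimates together force tanh((a + c)/2) <= 2 tanh((b + e)/2), with equality
   for the equilateral triangle, and this makes the first estimate strong enough. *)
theory Submission
  imports Defs
begin

section \<open>The hyperboloid model\<close>

text \<open>The value \<open>\<kappa> = 1/2\<close>, at which the heights of an equilateral triangle
  cross under 120 degrees, decides which estimate carries the argument. For
  \<open>\<kappa> \<ge> 1/2\<close> the two half-plane conditions alone give the tanh bound. For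
  smaller \<kappa> they weaken, and for \<kappa> \<le> 0 they are vacuous: b and e could then
  vanish, leaving only cosh |v_i v_j| <= cosh^2 Delta, which is too weak. There the comparison of
  arcs takes over. The factor 2 is 1 / cos 60, the ratio of the tanh of the circumradius to the tanh
  of the inradius in an equilateral triangle. For unequal a and c both estimates are weakened to
  their values at a = c with the same sum, so that only the half sums (a + c)/2 and (b + e)/2
  remain. Strictness comes from the last polynomial inequality: with q = tanh((b + e)/2), even the
  equality case of the tanh bound keeps a slack of 9 q^4. As Delta tends to 0 the bound approaches
  Delta * 2 / sqrt 3, the side of a Euclidean equilateral triangle of height Delta; this explains
  the 1/3.\<close>

definition mink :: "(real^2) \<times> real \<Rightarrow> (real^2) \<times> real \<Rightarrow> real" where
  "mink x y = fst x \<bullet> fst y - snd x * snd y"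

lemma mink_commute: "mink x y = mink y x"
  by (simp add: mink_def inner_commute mult.commute)

lemma mink_linear [simp]:
  "mink (x + y) z = mink x z + mink y z" "mink z (x + y) = mink z x + mink z y"
  "mink (x - y) z = mink x z - mink y z" "mink z (x - y) = mink z x - mink z y"
  "mink (c *\<^sub>R x) z = c * mink x z" "mink z (c *\<^sub>R x) = c * mink z x"
  by (simp_all add: mink_def inner_simps algebra_simps)

text \<open>Euclidean Cauchy-Schwarz for the space parts. Positivity on the complement of a timelike
  vector is what allows Euclidean arguments with tangent vectors in spite of the indefinite
  form.\<close>

lemma mink_orthogonal_nonneg:
  assumes "mink y y < 0" "mink y x = 0"
  shows "mink x x \<ge> 0"
proof -
  let ?a = "fst x" and ?s = "snd x" and ?b = "fst y" and ?t = "snd y"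
  have b: "?b \<bullet> ?b < ?t\<^sup>2" and st: "?b \<bullet> ?a = ?t * ?s"
    using assms by (simp_all add: mink_def power2_eq_square)
  have "?t\<^sup>2 * ?s\<^sup>2 = (?b \<bullet> ?a)\<^sup>2"
    by (simp add: st power_mult_distrib)
  also have "\<dots> \<le> (?b \<bullet> ?b) * (?a \<bullet> ?a)"
    by (rule Cauchy_Schwarz_ineq)
  also have "\<dots> \<le> ?t\<^sup>2 * (?a \<bullet> ?a)"
    using b by (intro mult_right_mono) auto
  finally have "?t\<^sup>2 * ?s\<^sup>2 \<le> ?t\<^sup>2 * (?a \<bullet> ?a)" .
  moreover have "?t\<^sup>2 > 0"
    using b inner_ge_zero[of ?b] by linarith
  ultimately have "?s\<^sup>2 \<le> ?a \<bullet> ?a"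
    by simp
  then show ?thesis
    by (simp add: mink_def power2_eq_square)
qed

lemma mink_orthogonal_Cauchy_Schwarz:
  assumes y: "mink y y < 0" and u: "mink y u = 0" and v: "mink y v = 0"
  shows "(mink u v)\<^sup>2 \<le> mink u u * mink v v"
proof -
  have nonneg: "mink (\<alpha> *\<^sub>R u + \<beta> *\<^sub>R v) (\<alpha> *\<^sub>R u + \<beta> *\<^sub>R v) \<ge> 0" for \<alpha> \<beta>
    by (rule mink_orthogonal_nonneg[OF y]) (simp add: u v)
  have q: "\<alpha>\<^sup>2 * mink u u + 2 * \<alpha> * \<beta> * mink u v + \<beta>\<^sup>2 * mink v v \<ge> 0" for \<alpha> \<beta>
    using nonneg[of \<alpha> \<beta>] by (simp add: mink_commute[of v u] power2_eq_square algebra_simps)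
  have uv: "mink u u \<ge> 0" "mink v v \<ge> 0"
    using q[of 1 0] q[of 0 1] by simp_all
  show ?thesis
  proof (cases "mink v v = 0")
    case False
    have "mink v v * (mink u u * mink v v - (mink u v)\<^sup>2) \<ge> 0"
      using q[of "mink v v" "- mink u v"] by (simp add: power2_eq_square algebra_simps)
    with False uv show ?thesis
      by (simp add: zero_le_mult_iff)
  next
    case True
    have "\<beta> * mink u v * 2 \<le> mink u u" for \<beta>
      using q[of 1 "- \<beta>"] True by simp
    \<comment> \<open>An affine function of \<beta> that is bounded above is constant; this \<beta>
      would make the left side \<open>mink u u + 1\<close>.\<close>
    from this[of "(mink u u + 1) / (2 * mink u v)"] have "mink u v = 0"
      by (cases "mink u v = 0") auto
    with True show ?thesis by simp
  qed
qed

section \<open>Points of the Klein disk on the hyperboloid\<close>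

definition lift :: "hpt \<Rightarrow> (real^2) \<times> real" where
  "lift x = (1 / sqrt (1 - (norm x)\<^sup>2)) *\<^sub>R (x, 1)"

lemma hpoint_pos: "hpoint x \<Longrightarrow> 1 - (norm x)\<^sup>2 > 0"
  by (simp add: hpoint_def abs_square_less_1)

lemma mink_lift_lift:
  "mink (lift x) (lift y) = - ((1 - x \<bullet> y) / sqrt ((1 - (norm x)\<^sup>2) * (1 - (norm y)\<^sup>2)))"
  by (simp add: lift_def mink_def inner_simps real_sqrt_mult diff_divide_distrib)

lemma hdist_lift: "hdist x y = arcosh (- mink (lift x) (lift y))"
  by (simp add: hdist_def mink_lift_lift)

lemma mink_lift_self: "hpoint x \<Longrightarrow> mink (lift x) (lift x) = -1"
  using hpoint_pos[of x] by (simp add: mink_lift_lift power2_norm_eq_inner)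

lemma cross2_Lagrange: "(x \<bullet> y)\<^sup>2 + (cross2 x y)\<^sup>2 = (norm x)\<^sup>2 * (norm y)\<^sup>2"
  unfolding power2_norm_eq_inner
  by (simp add: cross2_def inner_vec_def sum_2 power2_eq_square algebra_simps)

text \<open>The first summand makes the argument of arcosh at least 1; the second makes it exceed 1
  for distinct points.\<close>

lemma hpoint_gap:
  assumes "hpoint x" "hpoint y"
  shows "(1 - x \<bullet> y)\<^sup>2 \<ge> (1 - (norm x)\<^sup>2) * (1 - (norm y)\<^sup>2) + (1 - (norm x)\<^sup>2) * (norm (y - x))\<^sup>2"
proof -
  have "(1 - x \<bullet> y)\<^sup>2 - (1 - (norm x)\<^sup>2) * (1 - (norm y)\<^sup>2) = (norm (y - x))\<^sup>2 - (cross2 x (y - x))\<^sup>2"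
    unfolding power2_norm_eq_inner
    by (simp add: cross2_def inner_vec_def sum_2 power2_eq_square algebra_simps)
  moreover have "(cross2 x (y - x))\<^sup>2 \<le> (norm x)\<^sup>2 * (norm (y - x))\<^sup>2"
    using cross2_Lagrange[of x "y - x"] zero_le_power2[of "x \<bullet> (y - x)"] by linarith
  ultimately show ?thesis by (simp add: algebra_simps)
qed

lemma inner_less_1:
  assumes "hpoint x" "hpoint y"
  shows "x \<bullet> y < 1"
proof -
  have "x \<bullet> y \<le> norm x * norm y"
    by (rule norm_cauchy_schwarz)
  also have "\<dots> \<le> norm x * 1"
    using assms by (intro mult_left_mono) (auto simp: hpoint_def)
  finally show ?thesis using assms by (simp add: hpoint_def)
qed

lemma minus_mink_lift_ge_1:
  assumes "hpoint x" "hpoint y"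
  shows "- mink (lift x) (lift y) \<ge> 1"
proof -
  let ?d = "(1 - (norm x)\<^sup>2) * (1 - (norm y)\<^sup>2)"
  have d: "?d > 0" using assms by (intro mult_pos_pos hpoint_pos)
  have "(1 - x \<bullet> y)\<^sup>2 \<ge> ?d"
    using hpoint_gap[OF assms] hpoint_pos[OF assms(1)]
    by (smt (verit) mult_nonneg_nonneg zero_le_power2)
  then have "sqrt ?d \<le> 1 - x \<bullet> y"
    using inner_less_1[OF assms] by (intro real_le_lsqrt) auto
  then show ?thesis using d by (simp add: mink_lift_lift)
qed

lemma minus_mink_lift_eq_1:
  assumes "hpoint x" "hpoint y" "- mink (lift x) (lift y) \<le> 1"
  shows "x = y"
proof -
  let ?d = "(1 - (norm x)\<^sup>2) * (1 - (norm y)\<^sup>2)"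
  have d: "?d > 0" using assms by (intro mult_pos_pos hpoint_pos)
  have "1 - x \<bullet> y \<le> sqrt ?d" using assms d by (simp add: mink_lift_lift)
  then have "(1 - x \<bullet> y)\<^sup>2 \<le> ?d"
    using inner_less_1[OF assms(1,2)] d by (metis diff_gt_0_iff_gt less_eq_real_def power_mono real_sqrt_pow2)
  then have "(1 - (norm x)\<^sup>2) * (norm (y - x))\<^sup>2 \<le> 0"
    using hpoint_gap[OF assms(1,2)] by linarith
  then show ?thesis
    using hpoint_pos[OF assms(1)] by (simp add: mult_le_0_iff)
qed

section \<open>Triangle inequality and additivity along segments\<close>

lemma cosh_hdist: "hpoint x \<Longrightarrow> hpoint y \<Longrightarrow> cosh (hdist x y) = - mink (lift x) (lift y)"
  using minus_mink_lift_ge_1 by (simp add: hdist_lift cosh_arcosh_real)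

lemma hdist_nonneg: "hpoint x \<Longrightarrow> hpoint y \<Longrightarrow> hdist x y \<ge> 0"
  using minus_mink_lift_ge_1 by (simp add: hdist_lift)

lemma hdist_commute: "hdist x y = hdist y x"
  by (simp add: hdist_lift mink_commute)

text \<open>\<open>u\<close> is the tangent vector at \<open>y\<close> along the geodesic to
  \<open>x\<close>, of length \<open>sinh (hdist x y)\<close>. With such vectors the law of cosines
  is a plain expansion of the form.\<close>

lemma hdist_decompose:
  assumes "hpoint x" "hpoint y"
  defines "u \<equiv> lift x - cosh (hdist x y) *\<^sub>R lift y"
  shows "mink (lift y) u = 0" "mink u u = (sinh (hdist x y))\<^sup>2"
  using assms cosh_hdist[of x y] cosh_square_eq[of "hdist x y"]
  by (simp_all add: mink_lift_self mink_commute[of "lift y" "lift x"] power2_eq_square algebra_simps)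

text \<open>In the law of cosines at \<open>y\<close>, Cauchy-Schwarz bounds the mixed term by the
  product of the two sinh factors; the addition theorem for cosh does the rest.\<close>

lemma hdist_triangle:
  assumes "hpoint x" "hpoint y" "hpoint z"
  shows "hdist x z \<le> hdist x y + hdist y z"
proof -
  define u v where "u = lift x - cosh (hdist x y) *\<^sub>R lift y" and "v = lift z - cosh (hdist z y) *\<^sub>R lift y"
  note uv = hdist_decompose[OF assms(1,2), folded u_def] hdist_decompose[OF assms(3,2), folded v_def]
  have "(mink u v)\<^sup>2 \<le> (sinh (hdist x y))\<^sup>2 * (sinh (hdist z y))\<^sup>2"
    using mink_orthogonal_Cauchy_Schwarz[of "lift y" u v] uv assms(2) by (simp add: mink_lift_self)
  then have "(- mink u v)\<^sup>2 \<le> (sinh (hdist x y) * sinh (hdist z y))\<^sup>2"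
    by (simp add: power_mult_distrib)
  then have "- mink u v \<le> sinh (hdist x y) * sinh (hdist z y)"
    by (rule power2_le_imp_le) (use assms hdist_nonneg in auto)
  moreover have "mink (lift x) (lift z) = mink (u + cosh (hdist x y) *\<^sub>R lift y) (v + cosh (hdist z y) *\<^sub>R lift y)"
    by (simp add: u_def v_def)
  then have "cosh (hdist x z) = cosh (hdist x y) * cosh (hdist z y) - mink u v"
    using uv assms cosh_hdist[of x z] by (simp add: mink_lift_self mink_commute[of u "lift y"])
  ultimately have "cosh (hdist x z) \<le> cosh (hdist x y + hdist z y)"
    by (simp add: cosh_add)
  then show ?thesis
    using assms hdist_nonneg by (subst (asm) cosh_real_nonneg_le_iff) (auto simp: hdist_commute)
qed

lemma hpoint_segment:
  assumes "hpoint x" "hpoint z" "y \<in> closed_segment x z"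
  shows "hpoint y"
proof -
  have "closed_segment x z \<subseteq> ball 0 1"
    using assms by (intro closed_segment_subset) (auto simp: hpoint_def)
  with assms(3) show ?thesis
    by (auto simp: hpoint_def)
qed

lemma lift_in_segment:
  assumes "hpoint x" "hpoint z" "y \<in> closed_segment x z"
  obtains \<alpha> \<beta> where "\<alpha> \<ge> 0" "\<beta> \<ge> 0" "lift y = \<alpha> *\<^sub>R lift x + \<beta> *\<^sub>R lift z"
proof -
  obtain u where u: "0 \<le> u" "u \<le> 1" "y = (1 - u) *\<^sub>R x + u *\<^sub>R z"
    using assms(3) by (auto simp: in_segment)
  have y: "hpoint y"
    using assms by (rule hpoint_segment)
  define g where "g x = sqrt (1 - (norm x)\<^sup>2)" for x :: hpt
  have g: "g x > 0" "g y > 0" "g z > 0"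
    using assms y hpoint_pos by (auto simp: g_def)
  have "lift y = ((1 - u) * g x / g y) *\<^sub>R lift x + (u * g z / g y) *\<^sub>R lift z"
    unfolding lift_def g_def[symmetric] prod_eq_iff using g
    by (simp add: u(3) scaleR_add_right add_divide_distrib[symmetric])
  then show ?thesis
    using u g by (intro that[of "(1 - u) * g x / g y" "u * g z / g y"]) auto
qed

text \<open>The tangent vectors at \<open>y\<close> satisfy
  \<open>\<alpha> *\<^sub>R u + \<beta> *\<^sub>R v = 0\<close> with nonnegative coefficients, so
  they point in opposite directions: Cauchy-Schwarz becomes an equality with
  \<open>mink u v \<le> 0\<close>.\<close>

lemma hdist_segment:
  assumes "hpoint x" "hpoint z" "y \<in> closed_segment x z"
  shows "hdist x z = hdist x y + hdist y z"
proof -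
  note y = hpoint_segment[OF assms]
  obtain \<alpha> \<beta> where ab: "\<alpha> \<ge> 0" "\<beta> \<ge> 0" "lift y = \<alpha> *\<^sub>R lift x + \<beta> *\<^sub>R lift z"
    using lift_in_segment[OF assms] by blast
  define p q where "p = cosh (hdist x y)" and "q = cosh (hdist z y)"
  define u v where "u = lift x - p *\<^sub>R lift y" and "v = lift z - q *\<^sub>R lift y"
  note uv = hdist_decompose[OF assms(1) y, folded p_def u_def] hdist_decompose[OF assms(2) y, folded q_def v_def]
  have "mink (lift y) (\<alpha> *\<^sub>R lift x + \<beta> *\<^sub>R lift z) = - (\<alpha> * p + \<beta> * q)"
    using cosh_hdist[OF assms(1) y] cosh_hdist[OF assms(2) y]
    by (simp add: p_def q_def mink_commute algebra_simps)
  then have pq: "\<alpha> * p + \<beta> * q = 1"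
    using mink_lift_self[OF y] ab(3) by simp
  have "\<alpha> *\<^sub>R u + \<beta> *\<^sub>R v = lift y - (\<alpha> * p + \<beta> * q) *\<^sub>R lift y"
    by (simp add: u_def v_def ab(3) algebra_simps)
  then have 0: "\<alpha> *\<^sub>R u + \<beta> *\<^sub>R v = 0" by (simp add: pq)
  have 1: "\<alpha> * mink u u + \<beta> * mink u v = 0" "\<alpha> * mink u v + \<beta> * mink v v = 0"
    using arg_cong[OF 0, of "mink u"] arg_cong[OF 0, of "mink v"]
    by (simp_all add: mink_commute[of v u]) (simp_all add: mink_def)
  have "\<alpha> > 0 \<or> \<beta> > 0" using ab pq by (cases "\<alpha> = 0"; cases "\<beta> = 0") auto
  then have sq: "(mink u v)\<^sup>2 = mink u u * mink v v"
  proof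
    assume "\<alpha> > 0"
    then have "mink u u = - (\<beta> / \<alpha>) * mink u v" "mink u v = - (\<beta> / \<alpha>) * mink v v"
      using 1 by (simp_all add: field_simps)
    then show ?thesis by (simp add: power2_eq_square)
  next
    assume "\<beta> > 0"
    then have "mink v v = - (\<alpha> / \<beta>) * mink u v" "mink u v = - (\<alpha> / \<beta>) * mink u u"
      using 1 by (simp_all add: field_simps)
    then show ?thesis by (simp add: power2_eq_square)
  qed
  have le: "mink u v \<le> 0"
  proof (rule ccontr)
    assume "\<not> ?thesis"
    then have "mink u v > 0" by simp
    moreover have "\<alpha> * mink u u \<ge> 0" "\<beta> * mink v v \<ge> 0" using uv ab by simp_all
    ultimately show False using \<open>\<alpha> > 0 \<or> \<beta> > 0\<close> 1
      by (smt (verit) mult_nonneg_nonneg mult_pos_pos ab)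
  qed
  have "(- mink u v)\<^sup>2 = (sinh (hdist x y) * sinh (hdist z y))\<^sup>2"
    using sq uv by (simp add: power_mult_distrib)
  then have uv': "- mink u v = sinh (hdist x y) * sinh (hdist z y)"
    using le assms y hdist_nonneg by (subst (asm) power2_eq_iff_nonneg) auto
  have "mink (lift x) (lift z) = mink (u + p *\<^sub>R lift y) (v + q *\<^sub>R lift y)"
    by (simp add: u_def v_def)
  then have "cosh (hdist x z) = cosh (hdist x y + hdist z y)"
    using uv assms y uv' cosh_hdist[of x z]
    by (simp add: mink_lift_self mink_commute[of u "lift y"] cosh_add p_def q_def)
  then show ?thesis
    using assms y hdist_nonneg arcosh_cosh_real[of "hdist x z"] arcosh_cosh_real[of "hdist x y + hdist z y"]
    by (simp add: hdist_commute)
qed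

section \<open>Orientation and unit normals of lines\<close>

definition orient :: "hpt \<Rightarrow> hpt \<Rightarrow> hpt \<Rightarrow> real" where
  "orient a b c = cross2 (b - a) (c - a)"

lemma orient_coords:
  "orient a b c = (b$1 - a$1) * (c$2 - a$2) - (b$2 - a$2) * (c$1 - a$1)"
  by (simp add: orient_def cross2_def)

lemma orient_rotate: "orient a b c = orient b c a"
  by (simp add: orient_coords algebra_simps)

lemma orient_swap: "orient a b c = - orient a c b"
  by (simp add: orient_coords algebra_simps)

lemma orient_same [simp]: "orient a b a = 0" "orient a b b = 0" "orient a a b = 0"
  by (simp_all add: orient_coords)

lemma orient_segment:
  "orient a b ((1 - u) *\<^sub>R c + u *\<^sub>R d) = (1 - u) * orient a b c + u * orient a b d"
  by (simp add: orient_coords algebra_simps)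

lemma orient_closed_segment_nonneg:
  "x \<in> closed_segment c d \<Longrightarrow> orient a b c \<ge> 0 \<Longrightarrow> orient a b d \<ge> 0 \<Longrightarrow> orient a b x \<ge> 0"
  by (auto simp: in_segment orient_segment)

lemma orient_open_segment_pos:
  assumes "x \<in> open_segment c d" "orient a b c \<ge> 0" "orient a b d \<ge> 0"
    and "orient a b c > 0 \<or> orient a b d > 0"
  shows "orient a b x > 0"
proof -
  obtain u where u: "0 < u" "u < 1" "x = (1 - u) *\<^sub>R c + u *\<^sub>R d"
    using assms(1) by (auto simp: in_segment)
  have "(1 - u) * orient a b c \<ge> 0" "u * orient a b d \<ge> 0"
    using u assms by simp_all
  moreover have "(1 - u) * orient a b c > 0 \<or> u * orient a b d > 0"
    using u assms by auto
  ultimately show ?thesis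
    by (auto simp: u(3) orient_segment)
qed

text \<open>A Grassmann-Pluecker relation among the four directions out of \<open>a\<close>. Within
  the half plane to the left of \<open>a e\<close>, the sign of \<open>orient a\<close> thus orders
  the points by angle.\<close>

lemma orient_trans:
  assumes "orient a e x \<ge> 0" "orient a e y > 0" "orient a e z > 0"
    and "orient a x y > 0" "orient a y z > 0"
  shows "orient a x z > 0"
proof -
  have "orient a x z * orient a e y = orient a x y * orient a e z + orient a y z * orient a e x"
    by (simp add: orient_coords algebra_simps)
  also have "\<dots> > 0"
    using assms by (intro add_pos_nonneg mult_pos_pos mult_nonneg_nonneg) auto
  finally show ?thesis
    using assms(2) by (simp add: zero_less_mult_iff)
qed

lemma cross2_eq_0_obtains:
  assumes "cross2 r x = 0" "r \<noteq> 0"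
  obtains c where "x = c *\<^sub>R r"
proof -
  have *: "r$1 * x$2 = r$2 * x$1" using assms by (simp add: cross2_def)
  have "r$1 \<noteq> 0 \<or> r$2 \<noteq> 0"
    using assms(2) by (auto simp: vec_eq_iff forall_2)
  then show ?thesis
  proof
    assume "r$1 \<noteq> 0"
    then show ?thesis using *
      by (intro that[of "x$1 / r$1"]) (simp add: vec_eq_iff forall_2 field_simps)
  next
    assume "r$2 \<noteq> 0"
    then show ?thesis using *
      by (intro that[of "x$2 / r$2"]) (simp add: vec_eq_iff forall_2 field_simps)
  qed
qed

lemma orient_eq_0_obtains:
  assumes "orient a b x = 0" "a \<noteq> b"
  obtains c where "x = a + c *\<^sub>R (b - a)"
  using cross2_eq_0_obtains[of "b - a" "x - a"] assms
  by (metis add.commute diff_add_cancel eq_iff_diff_eq_0 orient_def)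

lemma segments_cross:
  assumes "orient a b c < 0" "orient a b d > 0" "orient c d a > 0" "orient c d b < 0"
  obtains x where "x \<in> closed_segment a b" "x \<in> closed_segment c d"
proof -
  define s where "s = orient c d a / (orient c d a - orient c d b)"
  have s: "0 \<le> s" "s \<le> 1" using assms by (auto simp: s_def field_simps)
  define x where "x = (1 - s) *\<^sub>R a + s *\<^sub>R b"
  have "(1 - s) * orient c d a + s * orient c d b = 0"
    using assms by (simp add: s_def field_simps)
  then have "orient c d x = 0"
    unfolding x_def orient_segment .
  moreover have "c \<noteq> d" using assms by auto
  ultimately obtain r where "x = c + r *\<^sub>R (d - c)"
    by (rule orient_eq_0_obtains)
  then have r: "x = (1 - r) *\<^sub>R c + r *\<^sub>R d" by (simp add: algebra_simps)
  have "orient a b x = 0" by (simp add: x_def orient_segment)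
  then have "(1 - r) * orient a b c + r * orient a b d = 0"
    by (simp add: r orient_segment)
  then have "r * (orient a b d - orient a b c) = - orient a b c" by (simp add: algebra_simps)
  moreover have "orient a b d - orient a b c > 0" using assms by simp
  ultimately have "0 \<le> r" "r \<le> 1"
    using assms mult_right_le_imp_le[of 0 "orient a b d - orient a b c" r]
      mult_right_le_imp_le[of r "orient a b d - orient a b c" 1] by simp_all
  then have "x \<in> closed_segment c d" using r by (auto simp: in_segment)
  moreover have "x \<in> closed_segment a b" using s by (auto simp: in_segment x_def)
  ultimately show ?thesis using that by blast
qed

text \<open>The Minkowski-unit normal of the line \<open>p q\<close>, pointing to its left. Its
  product with \<open>lift x\<close> is the sinh of the signed distance from \<open>x\<close> to the
  line, so orientation signs in the disk and Minkowski products can be exchanged.\<close>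

definition normal :: "hpt \<Rightarrow> hpt \<Rightarrow> (real^2) \<times> real" where
  "normal p q = (1 / sqrt ((norm (q - p))\<^sup>2 - (cross2 (q - p) p)\<^sup>2)) *\<^sub>R
     (vector [- (q - p)$2, (q - p)$1], cross2 (q - p) p)"

lemma normal_scale_pos:
  assumes "hpoint p" "p \<noteq> q"
  shows "(norm (q - p))\<^sup>2 - (cross2 (q - p) p)\<^sup>2 > 0"
proof -
  have "(cross2 (q - p) p)\<^sup>2 \<le> (norm (q - p))\<^sup>2 * (norm p)\<^sup>2"
    using cross2_Lagrange[of "q - p" p] zero_le_power2[of "(q - p) \<bullet> p"] by linarith
  also have "\<dots> < (norm (q - p))\<^sup>2 * 1"
    using assms hpoint_pos[of p] by (intro mult_strict_left_mono) auto
  finally show ?thesis by simp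
qed

lemma mink_normal_lift:
  "mink (normal p q) (lift x) =
     orient p q x / (sqrt ((norm (q - p))\<^sup>2 - (cross2 (q - p) p)\<^sup>2) * sqrt (1 - (norm x)\<^sup>2))"
proof -
  have "mink (vector [- (q - p)$2, (q - p)$1], cross2 (q - p) p) (x, 1) = orient p q x"
    by (simp add: mink_def orient_coords cross2_def inner_vec_def sum_2 algebra_simps)
  then show ?thesis
    unfolding normal_def lift_def mink_linear by simp
qed

lemma mink_normal_lift_iff:
  assumes "hpoint p" "p \<noteq> q" "hpoint x"
  shows "mink (normal p q) (lift x) > 0 \<longleftrightarrow> orient p q x > 0"
    "mink (normal p q) (lift x) < 0 \<longleftrightarrow> orient p q x < 0"
    "mink (normal p q) (lift x) \<ge> 0 \<longleftrightarrow> orient p q x \<ge> 0"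
    "mink (normal p q) (lift x) = 0 \<longleftrightarrow> orient p q x = 0"
proof -
  define k where "k = sqrt ((norm (q - p))\<^sup>2 - (cross2 (q - p) p)\<^sup>2) * sqrt (1 - (norm x)\<^sup>2)"
  have "k > 0"
    using normal_scale_pos[OF assms(1,2)] hpoint_pos[OF assms(3)] by (simp add: k_def)
  moreover have "mink (normal p q) (lift x) = orient p q x / k"
    by (simp add: mink_normal_lift k_def)
  ultimately show "mink (normal p q) (lift x) > 0 \<longleftrightarrow> orient p q x > 0"
    "mink (normal p q) (lift x) < 0 \<longleftrightarrow> orient p q x < 0"
    "mink (normal p q) (lift x) \<ge> 0 \<longleftrightarrow> orient p q x \<ge> 0"
    "mink (normal p q) (lift x) = 0 \<longleftrightarrow> orient p q x = 0"
    by (simp_all add: zero_less_divide_iff divide_less_0_iff zero_le_divide_iff)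
qed

lemma mink_normal_self:
  assumes "hpoint p" "p \<noteq> q"
  shows "mink (normal p q) (normal p q) = 1"
proof -
  have "mink (vector [- (q - p)$2, (q - p)$1], cross2 (q - p) p)
      (vector [- (q - p)$2, (q - p)$1], cross2 (q - p) p) = (norm (q - p))\<^sup>2 - (cross2 (q - p) p)\<^sup>2"
    unfolding power2_norm_eq_inner
    by (simp add: mink_def inner_vec_def sum_2 power2_eq_square algebra_simps)
  then show ?thesis
    using normal_scale_pos[OF assms] unfolding normal_def mink_linear by simp
qed

section \<open>Points from timelike vectors, and feet of perpendiculars\<close>

lemma timelike_lift:
  assumes "mink x x < 0" "hpoint a" "mink x (lift a) < 0"
  obtains p where "hpoint p" "lift p = (1 / sqrt (- mink x x)) *\<^sub>R x"
proof -
  obtain y s where x: "x = (y, s)" by (cases x)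
  have ys: "mink x x = (norm y)\<^sup>2 - s\<^sup>2"
    unfolding x mink_def power2_norm_eq_inner by (simp add: power2_eq_square)
  have s: "s \<noteq> 0"
    using assms(1) ys by auto
  define p where "p = (1 / s) *\<^sub>R y"
  have p1: "1 - (norm p)\<^sup>2 = - mink x x / s\<^sup>2"
    using s by (simp add: p_def ys power_mult_distrib power_divide field_simps)
  have "(norm p)\<^sup>2 < 1"
    using p1 assms(1) s by (smt (verit) divide_pos_pos zero_less_power2)
  then have p: "hpoint p"
    by (simp add: hpoint_def abs_square_less_1)
  have sq: "sqrt (1 - (norm p)\<^sup>2) = sqrt (- mink x x) / \<bar>s\<bar>"
    unfolding p1 real_sqrt_divide by simp
  have "(p, 1) = (1 / s) *\<^sub>R x"
    using s by (simp add: x p_def)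
  then have l: "lift p = (\<bar>s\<bar> / s / sqrt (- mink x x)) *\<^sub>R x"
    unfolding lift_def sq by simp
  \<comment> \<open>On the other sheet the product with \<open>lift a\<close> would have the
    opposite sign; \<open>a\<close> serves only to select the sheet.\<close>
  have "s > 0"
  proof (rule ccontr)
    assume "\<not> s > 0"
    then have sgn: "\<bar>s\<bar> / s = - 1" using s by simp
    have "mink (lift p) (lift a) = - mink x (lift a) / sqrt (- mink x x)"
      unfolding l sgn mink_linear by simp
    also have "\<dots> > 0" using assms by (simp add: divide_neg_pos)
    finally show False using minus_mink_lift_ge_1[OF p assms(2)] by simp
  qed
  then show ?thesis using p l that by simp
qed

text \<open>Turns the nearest-point definition of a foot into orthogonality. Removing the normal
  component from \<open>lift p\<close> and rescaling gives a point \<open>r\<close> of the line; it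
  is the unique nearest one, hence \<open>q\<close>.\<close>

lemma foot_decomposition:
  assumes p: "hpoint p" and a: "hpoint a" and ab: "a \<noteq> b" and pos: "orient a b p > 0"
    and foot: "is_foot p (hline_through a b) q"
  shows "lift p = cosh (hdist p q) *\<^sub>R lift q + sinh (hdist p q) *\<^sub>R normal a b"
    and "hdist p q > 0"
proof -
  define N s R where "N = normal a b" and "s = mink N (lift p)" and "R = lift p - s *\<^sub>R N"
  have NN: "mink N N = 1" unfolding N_def using a ab by (rule mink_normal_self)
  have s: "s > 0" using pos a ab p by (simp add: s_def N_def mink_normal_lift_iff)
  have q: "hpoint q" "q \<in> affine hull {a, b}"
    using foot by (auto simp: is_foot_def hline_through_def)
  have NR: "mink N R = 0" by (simp add: R_def s_def[symmetric] NN)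
  have PR: "mink R (lift p) = - (1 + s\<^sup>2)"
    using mink_lift_self[OF p] by (simp add: R_def s_def[symmetric] power2_eq_square)
  have RR: "mink R R = - (1 + s\<^sup>2)"
  proof -
    have "mink R R = mink R (lift p) - s * mink R N" by (subst (2) R_def) simp
    then show ?thesis using NR PR by (simp add: mink_commute)
  qed
  have s1: "1 + s\<^sup>2 > 0" by (simp add: add_pos_nonneg)
  obtain r where r: "hpoint r" "lift r = (1 / sqrt (1 + s\<^sup>2)) *\<^sub>R R"
  proof (rule timelike_lift[of R p])
    show "mink R R < 0" "mink R (lift p) < 0" using s1 by (simp_all add: RR PR)
  qed (simp_all add: p RR)
  have "mink N (lift r) = 0" by (simp add: r NR)
  then have "orient a b r = 0" using mink_normal_lift_iff(4)[OF a ab r(1)] by (simp only: N_def)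
  then obtain c where "r = a + c *\<^sub>R (b - a)" using ab by (rule orient_eq_0_obtains)
  then have "r = (1 - c) *\<^sub>R a + c *\<^sub>R b" by (simp add: algebra_simps)
  then have "r \<in> affine hull {a, b}"
    unfolding affine_hull_2 by (intro CollectI exI[of _ "1 - c"] exI[of _ c]) simp
  then have le: "hdist p q \<le> hdist p r"
    using foot r by (auto simp: is_foot_def hline_through_def)
  obtain c' where "q = (1 - c') *\<^sub>R a + c' *\<^sub>R b"
    using q(2) by (auto simp: affine_hull_2) (metis add_diff_cancel_right')
  then have "orient a b q = 0" by (simp add: orient_segment)
  then have Nq: "mink N (lift q) = 0" using mink_normal_lift_iff(4)[OF a ab q(1)] by (simp only: N_def)
  have P: "lift p = sqrt (1 + s\<^sup>2) *\<^sub>R lift r + s *\<^sub>R N"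
    using s1 by (simp add: r R_def)
  have "cosh (hdist p q) \<le> cosh (hdist p r)"
    using le p q r hdist_nonneg by (simp add: cosh_real_nonneg_le_iff)
  then have "- mink (lift p) (lift q) \<le> - mink (lift p) (lift r)"
    using p q r by (simp add: cosh_hdist)
  then have "sqrt (1 + s\<^sup>2) * (- mink (lift r) (lift q)) \<le> sqrt (1 + s\<^sup>2) * 1"
    using Nq \<open>mink N (lift r) = 0\<close> mink_lift_self[OF r(1)] by (simp add: P)
  then have "- mink (lift r) (lift q) \<le> 1"
    using s1 by (simp only: mult_le_cancel_left_pos real_sqrt_gt_0_iff)
  then have rq: "r = q" using minus_mink_lift_eq_1 r q by blast
  have ch: "cosh (hdist p q) = sqrt (1 + s\<^sup>2)"
    using p q cosh_hdist[of p q] \<open>mink N (lift r) = 0\<close> mink_lift_self[OF r(1)] by (simp add: P rq)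
  have "(sinh (hdist p q))\<^sup>2 = s\<^sup>2"
    using cosh_square_eq[of "hdist p q"] s1 by (simp add: ch)
  then have sh: "sinh (hdist p q) = s"
    using s p q hdist_nonneg by (subst (asm) power2_eq_iff_nonneg) auto
  show "lift p = cosh (hdist p q) *\<^sub>R lift q + sinh (hdist p q) *\<^sub>R normal a b"
    by (simp add: ch sh P rq N_def)
  show "hdist p q > 0" using sh s by (metis sinh_real_pos_iff)
qed

section \<open>The extremal inequality\<close>

text \<open>The difference of the sides is a term that vanishes for \<open>p = 2 * q\<close> plus
  one that stays positive as long as \<open>0 < q < p\<close>; here \<open>q > 0\<close> follows
  from \<open>q < p \<le> 2 * q\<close>.\<close>

lemma tanh_gap_inequality:
  fixes p q :: real
  assumes "0 \<le> p" "p < 1" "0 \<le> q" "q < p" "p \<le> 2 * q"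
  shows "3 * (1 - q\<^sup>2)\<^sup>2 < (1 + p * q)\<^sup>2 + 2 * (1 - p\<^sup>2) * (1 - q\<^sup>2)"
proof -
  have "(1 + p * q)\<^sup>2 + 2 * (1 - p\<^sup>2) * (1 - q\<^sup>2) - 3 * (1 - q\<^sup>2)\<^sup>2
      = 2 * (2 * q - p) * (q + p) + 3 * q\<^sup>2 * ((p - q) * (p + q))"
    by (simp add: power2_eq_square algebra_simps)
  moreover have "2 * (2 * q - p) * (q + p) \<ge> 0" using assms by simp
  moreover have "3 * q\<^sup>2 * ((p - q) * (p + q)) > 0" using assms by (intro mult_pos_pos) auto
  ultimately show ?thesis by linarith
qed

lemma cosh_mult_cosh: "2 * (cosh x * cosh y) = cosh (x + y) + cosh (x - y)" for x y :: real
  by (simp add: cosh_add cosh_diff)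

lemma sinh_mult_cosh: "2 * (sinh x * cosh y) = sinh (x + y) + sinh (x - y)" for x y :: real
  by (simp add: sinh_add sinh_diff)

lemma cosh_eq_half: "cosh x = 1 + 2 * (sinh (x / 2))\<^sup>2" for x :: real
  using cosh_add[of "x / 2" "x / 2"] cosh_square_eq[of "x / 2"] by (simp add: power2_eq_square)

lemma cosh_square_mult_tanh: "(cosh x)\<^sup>2 * (1 - (tanh x)\<^sup>2) = 1" for x :: real
proof -
  have "(cosh x)\<^sup>2 * (1 - (tanh x)\<^sup>2) = (cosh x)\<^sup>2 - (sinh x)\<^sup>2"
    by (simp add: tanh_def power_divide right_diff_distrib)
  then show ?thesis by (simp add: cosh_square_eq)
qed

text \<open>The last assumption is \<open>|v\<^sub>i v\<^sub>j| \<le> |t\<^sub>i p| + |p t\<^sub>j|\<close> after clearing denominators; in this form it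
  remains true (and is trivial) when the two sides do not meet.\<close>

lemma half_gap_bound:
  fixes a c b e \<Delta> \<kappa> X :: real
  assumes sum: "a + b = \<Delta>" "c + e = \<Delta>" and s: "a + c > \<Delta>" and be: "b \<ge> 0" "e \<ge> 0"
    and \<kappa>: "-1 < \<kappa>" "\<kappa> < 1"
    and X: "X = cosh a * cosh c + \<kappa> * (sinh a * sinh c)"
    and K1: "\<kappa> * (sinh c * cosh b) \<le> sinh b * cosh c"
    and K2: "\<kappa> * (sinh a * cosh e) \<le> sinh e * cosh a"
    and T: "X * (1 - sinh b * sinh e - \<kappa> * (cosh b * cosh e))
      \<le> cosh b * cosh e - \<kappa> * (1 - sinh b * sinh e)"
  shows "tanh ((a + c) / 2) \<le> 2 * tanh ((b + e) / 2)"
proof -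
  define A B where "A = (a + c) / 2" and "B = (b + e) / 2"
  have A: "A > 0" "A > B" and B: "B \<ge> 0" using sum s be by (auto simp: A_def B_def)
  have tB: "tanh B \<ge> 0" using B by simp
  show ?thesis
  proof (cases "\<kappa> \<ge> 1/2")
    case True
    define \<sigma> where "\<sigma> = sinh (a - e)"
    have \<sigma>: "\<sigma> > 0" "a - e = c - b" using s sum by (auto simp: \<sigma>_def)
    have *: "\<kappa> * (sinh \<Delta> + \<sigma>) \<le> sinh \<Delta> - \<sigma>"
    proof -
      define u where "u = a - c"
      have u: "\<Delta> - u = c + b" "\<Delta> + u = a + e" using sum by (auto simp: u_def)
      have 1: "\<kappa> * (sinh (\<Delta> - u) + \<sigma>) \<le> sinh (\<Delta> - u) - \<sigma>"
      proof -
        have "2 * (sinh c * cosh b) = sinh (c + b) + \<sigma>" "2 * (sinh b * cosh c) = sinh (c + b) - \<sigma>"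
          using sinh_mult_cosh[of c b] sinh_mult_cosh[of b c] sinh_minus[of "c - b"]
          by (simp_all add: \<sigma>_def \<sigma>(2) add.commute)
        moreover have "\<kappa> * (2 * (sinh c * cosh b)) \<le> 2 * (sinh b * cosh c)" using K1 by simp
        ultimately show ?thesis by (simp only: u)
      qed
      have 2: "\<kappa> * (sinh (\<Delta> + u) + \<sigma>) \<le> sinh (\<Delta> + u) - \<sigma>"
      proof -
        have "2 * (sinh a * cosh e) = sinh (a + e) + \<sigma>" "2 * (sinh e * cosh a) = sinh (a + e) - \<sigma>"
          using sinh_mult_cosh[of a e] sinh_mult_cosh[of e a] sinh_minus[of "a - e"]
          by (simp_all add: \<sigma>_def add.commute)
        moreover have "\<kappa> * (2 * (sinh a * cosh e)) \<le> 2 * (sinh e * cosh a)" using K2 by simp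
        ultimately show ?thesis by (simp only: u)
      qed
      \<comment> \<open>Facts 1 and 2 differ only in the sign of \<open>u\<close>. The one with the
        smaller argument is the stronger, and raising that argument to \<Delta> leaves the condition
        for \<open>a = c\<close>; \<sigma> depends on \<open>a + c\<close> alone.\<close>
      have "(1 + \<kappa>) * \<sigma> \<le> (1 - \<kappa>) * sinh (\<Delta> - \<bar>u\<bar>)"
        using 1 2 by (cases "u \<ge> 0") (simp_all add: algebra_simps)
      also have "\<dots> \<le> (1 - \<kappa>) * sinh \<Delta>"
        using \<kappa> by (intro mult_left_mono) auto
      finally show ?thesis by (simp add: algebra_simps)
    qed
    have "sinh \<Delta> + \<sigma> = 2 * (sinh A * cosh B)" "sinh \<Delta> - \<sigma> = 2 * (sinh B * cosh A)"
    proof -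
      have "A + B = \<Delta>" "A - B = a - e" using sum by (simp_all add: A_def B_def field_simps)
      moreover from this have "B - A = e - a" by linarith
      ultimately show "sinh \<Delta> + \<sigma> = 2 * (sinh A * cosh B)" "sinh \<Delta> - \<sigma> = 2 * (sinh B * cosh A)"
        using sinh_mult_cosh[of A B] sinh_mult_cosh[of B A] sinh_minus[of "A - B"]
        by (simp_all add: \<sigma>_def add.commute[of B A])
    qed
    with * have "\<kappa> * (sinh A * cosh B) \<le> sinh B * cosh A" by simp
    moreover have "1/2 * (sinh A * cosh B) \<le> \<kappa> * (sinh A * cosh B)"
      using True A by (intro mult_right_mono) auto
    ultimately have "sinh A * cosh B \<le> 2 * (sinh B * cosh A)" by linarith
    then show ?thesis
      unfolding A_def[symmetric] B_def[symmetric] by (simp add: tanh_def field_simps)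
  next
    case False
    define x y where "x = sinh b * sinh e" and "y = cosh b * cosh e"
    define Sa Sb where "Sa = (sinh A)\<^sup>2" and "Sb = (sinh B)\<^sup>2"
    have S: "Sa \<ge> 0" "Sb \<ge> 0" by (simp_all add: Sa_def Sb_def)
    have xy: "x + y - 1 = 2 * Sb"
      using cosh_eq_half[of "b + e"] by (simp add: x_def y_def Sb_def B_def cosh_add)
    have yx: "y - x \<ge> 1"
      using cosh_real_ge_1[of "b - e"] by (simp add: x_def y_def cosh_diff)
    have X1: "X - 1 \<ge> (1 + \<kappa>) * Sa"
    proof -
      have "2 * X = (1 + \<kappa>) * cosh (a + c) + (1 - \<kappa>) * cosh (a - c)"
        by (simp add: X cosh_add cosh_diff algebra_simps)
      moreover have "(1 - \<kappa>) * cosh (a - c) \<ge> (1 - \<kappa>) * 1"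
        using \<kappa> by (intro mult_left_mono cosh_real_ge_1) auto
      moreover have "cosh (a + c) = 1 + 2 * Sa"
        using cosh_eq_half[of "a + c"] by (simp add: Sa_def A_def)
      ultimately show ?thesis by (simp add: algebra_simps)
    qed
    have X0: "X - 1 \<ge> 0" using X1 \<kappa> S by (smt (verit) mult_nonneg_nonneg)
    \<comment> \<open>Assumption \<open>T\<close>, doubled and regrouped into products in which half
      arguments appear: \<open>x + y - 1\<close> is \<open>cosh (b + e) - 1\<close>, and
      \<open>y - x + 1\<close> is \<open>cosh (b - e) + 1\<close>, hence at least 2.\<close>
    have "(X - 1) * (1 - \<kappa>) * (y - x + 1) \<le> (X + 1) * (1 + \<kappa>) * (x + y - 1)"
      using T by (simp add: x_def[symmetric] y_def[symmetric] algebra_simps)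
    moreover have "(X - 1) * (1 - \<kappa>) * 2 \<le> (X - 1) * (1 - \<kappa>) * (y - x + 1)"
      using X0 \<kappa> yx by (intro mult_left_mono) auto
    ultimately have "(X - 1) * (1 - \<kappa>) \<le> (X + 1) * (1 + \<kappa>) * Sb" by (simp add: xy)
    then have D: "(X - 1) * ((1 - \<kappa>) - (1 + \<kappa>) * Sb) \<le> 2 * (1 + \<kappa>) * Sb"
      by (simp add: algebra_simps)
    have D': "Sa * ((1 - \<kappa>) - (1 + \<kappa>) * Sb) \<le> 2 * Sb"
    proof (cases "(1 - \<kappa>) - (1 + \<kappa>) * Sb \<ge> 0")
      case True
      have "(1 + \<kappa>) * (Sa * ((1 - \<kappa>) - (1 + \<kappa>) * Sb)) \<le> (X - 1) * ((1 - \<kappa>) - (1 + \<kappa>) * Sb)"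
        using mult_right_mono[OF X1 True] by (simp add: mult.assoc)
      also have "\<dots> \<le> (1 + \<kappa>) * (2 * Sb)" using D by (simp add: algebra_simps)
      finally show ?thesis using \<kappa> by simp
    next
      case False
      then show ?thesis using S by (smt (verit) mult_nonneg_nonpos)
    qed
    \<comment> \<open>Only \<open>1 - \<kappa> \<ge> 1/2\<close> and
      \<open>1 + \<kappa> \<le> 3/2\<close> are used; at \<open>\<kappa> = 1/2\<close> both are
      equalities. The outcome is the square of the tanh bound.\<close>
    have "Sa * (1/2) \<le> Sa * (1 - \<kappa>)" using False S by (intro mult_left_mono) auto
    moreover have "(1 + \<kappa>) * (Sa * Sb) \<le> 3/2 * (Sa * Sb)" using False S by (intro mult_right_mono) auto
    ultimately have "Sa \<le> 4 * Sb + 3 * (Sa * Sb)" using D' by (simp add: algebra_simps)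
    then have "Sa * (1 + Sb) \<le> 4 * Sb * (1 + Sa)" by (simp add: algebra_simps)
    then have "(sinh A * cosh B)\<^sup>2 \<le> (2 * (sinh B * cosh A))\<^sup>2"
      by (simp add: Sa_def Sb_def power_mult_distrib cosh_square_eq add.commute)
    then have "sinh A * cosh B \<le> 2 * (sinh B * cosh A)"
      by (rule power2_le_imp_le) (use B in auto)
    then show ?thesis
      unfolding A_def[symmetric] B_def[symmetric] by (simp add: tanh_def field_simps)
  qed
qed

text \<open>\<open>K1\<close> and \<open>K2\<close> bound \<kappa> in \<open>X * cosh b\<close> and
  \<open>X * cosh e\<close>, and the addition theorem collapses each to a multiple of
  \<open>cosh \<Delta>\<close>; their product is the first estimate. For
  \<open>a + c \<le> \<Delta>\<close> it already gives \<open>X \<le> cosh \<Delta>\<close>.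
  Otherwise everything reduces to a polynomial inequality in \<open>p = tanh A\<close> and
  \<open>q = tanh B\<close>.\<close>

lemma extremal_bound:
  fixes a c b e \<Delta> \<kappa> X :: real
  assumes nonneg: "a \<ge> 0" "b \<ge> 0" "c \<ge> 0" "e \<ge> 0"
    and sum: "a + b = \<Delta>" "c + e = \<Delta>" and \<Delta>: "\<Delta> > 0"
    and \<kappa>: "-1 < \<kappa>" "\<kappa> < 1"
    and X: "X = cosh a * cosh c + \<kappa> * (sinh a * sinh c)" and X1: "X \<ge> 1"
    and K1: "\<kappa> * (sinh c * cosh b) \<le> sinh b * cosh c"
    and K2: "\<kappa> * (sinh a * cosh e) \<le> sinh e * cosh a"
    and T: "X * (1 - sinh b * sinh e - \<kappa> * (cosh b * cosh e))
      \<le> cosh b * cosh e - \<kappa> * (1 - sinh b * sinh e)"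
  shows "3 * X\<^sup>2 < (cosh \<Delta>)\<^sup>2 * ((cosh \<Delta>)\<^sup>2 + 2)"
proof -
  define C where "C = cosh \<Delta>"
  have C: "C > 1" using \<Delta> cosh_real_nonneg_less_iff[of 0 \<Delta>] by (simp add: C_def)
  have Xb: "X * cosh b \<le> C * cosh c"
  proof -
    have "X * cosh b = cosh a * cosh b * cosh c + sinh a * (\<kappa> * (sinh c * cosh b))"
      by (simp add: X algebra_simps)
    also have "\<dots> \<le> cosh a * cosh b * cosh c + sinh a * (sinh b * cosh c)"
      using K1 nonneg by (intro add_left_mono mult_left_mono) auto
    also have "\<dots> = C * cosh c" by (simp add: C_def sum(1)[symmetric] cosh_add algebra_simps)
    finally show ?thesis .
  qed
  have Xe: "X * cosh e \<le> C * cosh a"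
  proof -
    have "X * cosh e = cosh c * cosh e * cosh a + sinh c * (\<kappa> * (sinh a * cosh e))"
      by (simp add: X algebra_simps)
    also have "\<dots> \<le> cosh c * cosh e * cosh a + sinh c * (sinh e * cosh a)"
      using K2 nonneg by (intro add_left_mono mult_left_mono) auto
    also have "\<dots> = C * cosh a" by (simp add: C_def sum(2)[symmetric] cosh_add algebra_simps)
    finally show ?thesis .
  qed
  have "(X * cosh b) * (X * cosh e) \<le> (C * cosh c) * (C * cosh a)"
    by (rule mult_mono[OF Xb Xe]) (use X1 C in auto)
  then have main: "X\<^sup>2 * (cosh b * cosh e) \<le> C\<^sup>2 * (cosh a * cosh c)"
    by (simp add: power2_eq_square algebra_simps)
  define s t \<delta> where "s = a + c" and "t = b + e" and "\<delta> = a - c"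
  have bd: "b - e = - \<delta>" using sum by (simp add: \<delta>_def)
  have main': "X\<^sup>2 * (cosh t + cosh \<delta>) \<le> C\<^sup>2 * (cosh s + cosh \<delta>)"
  proof -
    have "2 * (cosh b * cosh e) = cosh t + cosh \<delta>" "2 * (cosh a * cosh c) = cosh s + cosh \<delta>"
      using cosh_mult_cosh[of b e] cosh_mult_cosh[of a c] by (simp_all add: bd s_def t_def \<delta>_def)
    moreover have "X\<^sup>2 * (2 * (cosh b * cosh e)) \<le> C\<^sup>2 * (2 * (cosh a * cosh c))" using main by simp
    ultimately show ?thesis by simp
  qed
  have pos: "cosh t + cosh \<delta> > 0" by (simp add: add_pos_pos)
  have C2: "C\<^sup>2 > 1" using C by (simp add: one_less_power)
  have "3 * X\<^sup>2 < C\<^sup>2 * (C\<^sup>2 + 2)"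
  proof (cases "s \<le> \<Delta>")
    case True
    then have "s \<le> t" using sum by (simp add: s_def t_def)
    then have "cosh s \<le> cosh t"
      using nonneg by (simp add: s_def t_def cosh_real_nonneg_le_iff)
    then have "C\<^sup>2 * (cosh s + cosh \<delta>) \<le> C\<^sup>2 * (cosh t + cosh \<delta>)"
      by (intro mult_left_mono) auto
    then have "X\<^sup>2 * (cosh t + cosh \<delta>) \<le> C\<^sup>2 * (cosh t + cosh \<delta>)" using main' by linarith
    then have "X\<^sup>2 \<le> C\<^sup>2" using pos by simp
    moreover have "C\<^sup>2 * 3 < C\<^sup>2 * (C\<^sup>2 + 2)" using C2 by (intro mult_strict_left_mono) auto
    ultimately show ?thesis by simp
  next
    case False
    define A B where "A = s / 2" and "B = t / 2"
    define p q where "p = tanh A" and "q = tanh B"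
    have AB: "A > B" "B \<ge> 0" "A + B = \<Delta>"
      using False nonneg sum by (simp_all add: A_def B_def s_def t_def field_simps)
    have pq: "0 \<le> q" "q < p" "p < 1" "0 \<le> p"
      using AB by (auto simp: p_def q_def tanh_real_lt_1)
    have p2q: "p \<le> 2 * q"
      using half_gap_bound[OF sum _ nonneg(2,4) \<kappa> X K1 K2 T] False by (simp add: p_def q_def A_def B_def s_def t_def)
    have cs: "cosh s + 1 = 2 * (cosh A)\<^sup>2" "cosh t + 1 = 2 * (cosh B)\<^sup>2"
      using cosh_eq_half[of s] cosh_eq_half[of t] by (simp_all add: A_def B_def cosh_square_eq)
    \<comment> \<open>Since \<open>s \<ge> t\<close>, lowering \<open>cosh \<delta>\<close> to 1 can
      only raise the quotient of \<open>cosh s + cosh \<delta>\<close> by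
      \<open>cosh t + cosh \<delta>\<close>. This is the reduction to \<open>a = c\<close>.\<close>
    have le: "X\<^sup>2 * (cosh B)\<^sup>2 \<le> C\<^sup>2 * (cosh A)\<^sup>2"
    proof -
      have "cosh s \<ge> cosh t" using AB by (simp add: A_def B_def cosh_real_nonneg_le_iff)
      then have "(cosh s + cosh \<delta>) * (cosh t + 1) \<le> (cosh s + 1) * (cosh t + cosh \<delta>)"
      proof -
        have "(cosh s + 1) * (cosh t + cosh \<delta>) - (cosh s + cosh \<delta>) * (cosh t + 1) = (cosh s - cosh t) * (cosh \<delta> - 1)"
          by (simp add: algebra_simps)
        moreover have "\<dots> \<ge> 0" using \<open>cosh s \<ge> cosh t\<close> cosh_real_ge_1[of \<delta>] by simp
        ultimately show ?thesis by linarith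
      qed
      then have "C\<^sup>2 * ((cosh s + cosh \<delta>) * (cosh t + 1)) \<le> C\<^sup>2 * ((cosh s + 1) * (cosh t + cosh \<delta>))"
        by (intro mult_left_mono) auto
      moreover have "X\<^sup>2 * (cosh t + cosh \<delta>) * (cosh t + 1) \<le> C\<^sup>2 * (cosh s + cosh \<delta>) * (cosh t + 1)"
        using main' by (intro mult_right_mono) (auto simp: add_nonneg_nonneg)
      ultimately have "(X\<^sup>2 * (cosh t + 1)) * (cosh t + cosh \<delta>) \<le> (C\<^sup>2 * (cosh s + 1)) * (cosh t + cosh \<delta>)"
        by (simp add: mult.assoc mult.left_commute mult.commute)
      then have "X\<^sup>2 * (cosh t + 1) \<le> C\<^sup>2 * (cosh s + 1)" using pos by (simp only: mult_le_cancel_right_pos)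
      then show ?thesis by (simp add: cs)
    qed
    have ch: "(cosh A)\<^sup>2 * (1 - p\<^sup>2) = 1" "(cosh B)\<^sup>2 * (1 - q\<^sup>2) = 1"
      by (simp_all add: p_def q_def cosh_square_mult_tanh)
    have p1: "1 - p\<^sup>2 > 0" "1 - q\<^sup>2 > 0" using pq by (simp_all add: abs_square_less_1)
    have chd: "(cosh A)\<^sup>2 = 1 / (1 - p\<^sup>2)" "(cosh B)\<^sup>2 = 1 / (1 - q\<^sup>2)"
      using ch p1 by (simp_all add: field_simps)
    have CC: "C = cosh A * cosh B * (1 + p * q)"
      by (simp add: C_def AB(3)[symmetric] cosh_add p_def q_def tanh_def field_simps)
    have C2': "C\<^sup>2 = (1 + p * q)\<^sup>2 / ((1 - p\<^sup>2) * (1 - q\<^sup>2))"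
      by (simp add: CC power_mult_distrib chd)
    have "X\<^sup>2 \<le> C\<^sup>2 * ((1 - q\<^sup>2) / (1 - p\<^sup>2))"
      using le p1 by (simp add: chd field_simps)
    moreover have "3 * ((1 - q\<^sup>2) / (1 - p\<^sup>2)) < C\<^sup>2 + 2"
    proof -
      have "3 * ((1 - q\<^sup>2) / (1 - p\<^sup>2)) = 3 * (1 - q\<^sup>2)\<^sup>2 / ((1 - p\<^sup>2) * (1 - q\<^sup>2))"
        using p1 by (simp add: power2_eq_square)
      also have "\<dots> < ((1 + p * q)\<^sup>2 + 2 * (1 - p\<^sup>2) * (1 - q\<^sup>2)) / ((1 - p\<^sup>2) * (1 - q\<^sup>2))"
        using tanh_gap_inequality[of p q] pq p2q p1 by (intro divide_strict_right_mono) auto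
      also have "\<dots> = C\<^sup>2 + 2"
      proof -
        have "(u + 2 * m * n) / (m * n) = u / (m * n) + 2" if "m > 0" "n > 0" for u m n :: real
          using that by (simp add: field_simps)
        from this[OF p1] show ?thesis by (simp only: C2')
      qed
      finally show ?thesis .
    qed
    then have "C\<^sup>2 * (3 * ((1 - q\<^sup>2) / (1 - p\<^sup>2))) < C\<^sup>2 * (C\<^sup>2 + 2)"
      using C2 by (intro mult_strict_left_mono) auto
    moreover have "3 * (C\<^sup>2 * r) = C\<^sup>2 * (3 * r)" for r by simp
    ultimately show ?thesis
      by (smt (verit))
  qed
  then show ?thesis by (simp add: C_def)
qed

text \<open>Geometrically, \<open>u\<close> and \<open>v\<close> are the sinh of the signed
  distances of each foot from the line of the other side, and \<open>x + y * \<kappa>\<close> is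
  minus the product of the two unit side normals. So
  \<open>(1 + x + y * \<kappa>) * (1 - x - y * \<kappa>)\<close> is the Gram determinant of the
  normals.\<close>

lemma side_gap_identities:
  fixes b e \<kappa> :: real
  defines "x \<equiv> sinh b * sinh e" and "y \<equiv> cosh b * cosh e"
    and "u \<equiv> sinh e * cosh b + \<kappa> * (sinh b * cosh e)"
    and "v \<equiv> sinh b * cosh e + \<kappa> * (sinh e * cosh b)"
  shows "u * v = (1 + x + y * \<kappa>) * (y - \<kappa> * (1 - x)) - (1 - \<kappa>\<^sup>2) * y"
    and "u\<^sup>2 = (1 - \<kappa>\<^sup>2) * (cosh e)\<^sup>2 - (1 + x + y * \<kappa>) * (1 - x - y * \<kappa>)"
    and "v\<^sup>2 = (1 - \<kappa>\<^sup>2) * (cosh b)\<^sup>2 - (1 + x + y * \<kappa>) * (1 - x - y * \<kappa>)"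
proof -
  define p q r s where "p = sinh b" and "q = cosh b" and "r = sinh e" and "s = cosh e"
  have q: "q * q = 1 + p * p" and s: "s * s = 1 + r * r"
    using cosh_square_eq[of b] cosh_square_eq[of e] by (simp_all add: p_def q_def r_def s_def power2_eq_square)
  show "u * v = (1 + x + y * \<kappa>) * (y - \<kappa> * (1 - x)) - (1 - \<kappa>\<^sup>2) * y"
    unfolding u_def v_def x_def y_def p_def[symmetric] q_def[symmetric] r_def[symmetric] s_def[symmetric]
    using q s unfolding power2_eq_square by algebra
  show "u\<^sup>2 = (1 - \<kappa>\<^sup>2) * (cosh e)\<^sup>2 - (1 + x + y * \<kappa>) * (1 - x - y * \<kappa>)"
    unfolding u_def v_def x_def y_def p_def[symmetric] q_def[symmetric] r_def[symmetric] s_def[symmetric]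
    using q s unfolding power2_eq_square by algebra
  show "v\<^sup>2 = (1 - \<kappa>\<^sup>2) * (cosh b)\<^sup>2 - (1 + x + y * \<kappa>) * (1 - x - y * \<kappa>)"
    unfolding u_def v_def x_def y_def p_def[symmetric] q_def[symmetric] r_def[symmetric] s_def[symmetric]
    using q s unfolding power2_eq_square by algebra
qed

text \<open>The second quantity is the cosh of the distance between the feet minus \<kappa>. As
  \<open>u * v \<ge> 0\<close>, the first identity makes its product with
  \<open>1 + x + y * \<kappa>\<close> positive. Hence only the other factor of the Gram determinant
  can prevent the side lines from meeting.\<close>

lemma side_gap_pos:
  fixes b e \<kappa> :: real
  defines "x \<equiv> sinh b * sinh e" and "y \<equiv> cosh b * cosh e"
  assumes "b \<ge> 0" "e \<ge> 0" "-1 < \<kappa>" "\<kappa> < 1"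
    and u: "sinh e * cosh b + \<kappa> * (sinh b * cosh e) \<ge> 0"
    and v: "sinh b * cosh e + \<kappa> * (sinh e * cosh b) \<ge> 0"
  shows "1 + x + y * \<kappa> > 0" "y - \<kappa> * (1 - x) > 0"
proof -
  have x: "x \<ge> 0" using assms by (simp add: x_def)
  have y: "y \<ge> 1 + x" using cosh_real_ge_1[of "b - e"] by (simp add: x_def y_def cosh_diff)
  have \<kappa>: "\<bar>\<kappa>\<bar> < 1" using assms by simp
  have "\<bar>\<kappa> * (1 - x)\<bar> \<le> 1 * \<bar>1 - x\<bar>" unfolding abs_mult using \<kappa> by (intro mult_right_mono) auto
  show *: "y - \<kappa> * (1 - x) > 0"
  proof (cases "x = 0")
    case True then show ?thesis using \<kappa> y by simp
  next
    case False
    with x have "\<bar>1 - x\<bar> < 1 + x" by simp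
    then show ?thesis
      using \<open>\<bar>\<kappa> * (1 - x)\<bar> \<le> 1 * \<bar>1 - x\<bar>\<close> y abs_ge_self[of "\<kappa> * (1 - x)"] by simp
  qed
  have "\<kappa>\<^sup>2 < 1" using \<kappa> by (simp add: abs_square_less_1)
  then have "(1 - \<kappa>\<^sup>2) * y > 0" using x y by simp
  moreover have "(1 + x + y * \<kappa>) * (y - \<kappa> * (1 - x)) - (1 - \<kappa>\<^sup>2) * y \<ge> 0"
    using mult_nonneg_nonneg[OF u v] side_gap_identities(1)[where b = b and e = e and \<kappa> = \<kappa>] by (simp add: x_def y_def)
  ultimately have "(1 + x + y * \<kappa>) * (y - \<kappa> * (1 - x)) > 0" by linarith
  then show "1 + x + y * \<kappa> > 0" using * by (simp add: zero_less_mult_iff)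
qed

text \<open>The side lines meet if and only if \<open>1 - x - y * \<kappa> > 0\<close>; then \<open>k\<close> and \<open>l\<close> are the distances of
  the meeting point from the two feet.\<close>

lemma meeting_sides_bound:
  fixes b e \<kappa> k l X :: real
  defines "x \<equiv> sinh b * sinh e" and "y \<equiv> cosh b * cosh e"
  defines "W \<equiv> (1 - \<kappa>\<^sup>2) * ((1 + x + y * \<kappa>) * (1 - x - y * \<kappa>))"
  assumes be: "b \<ge> 0" "e \<ge> 0" and \<kappa>: "-1 < \<kappa>" "\<kappa> < 1"
    and u: "sinh e * cosh b + \<kappa> * (sinh b * cosh e) \<ge> 0"
    and v: "sinh b * cosh e + \<kappa> * (sinh e * cosh b) \<ge> 0"
    and meet: "1 - x - y * \<kappa> > 0"
    and kl: "k \<ge> 0" "l \<ge> 0"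
    and k: "cosh k = (1 - \<kappa>\<^sup>2) * cosh e / sqrt W" and l: "cosh l = (1 - \<kappa>\<^sup>2) * cosh b / sqrt W"
    and X: "X \<le> cosh (k + l)"
  shows "X * (1 - x - \<kappa> * y) \<le> y - \<kappa> * (1 - x)"
proof -
  define \<sigma> f g where "\<sigma> = 1 - \<kappa>\<^sup>2" and "f = 1 + x + y * \<kappa>" and "g = 1 - x - y * \<kappa>"
  have \<sigma>: "\<sigma> > 0" using \<kappa> by (simp add: \<sigma>_def abs_square_less_1)
  have f: "f > 0" using side_gap_pos(1)[OF be \<kappa> u v] by (simp add: f_def x_def y_def)
  have g: "g > 0" using meet by (simp add: g_def)
  have W: "W = \<sigma> * (f * g)" by (simp add: W_def \<sigma>_def f_def g_def)
  define u' v' where "u' = sinh e * cosh b + \<kappa> * (sinh b * cosh e)" and "v' = sinh b * cosh e + \<kappa> * (sinh e * cosh b)"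
  note ids = side_gap_identities[where b = b and e = e and \<kappa> = \<kappa>, folded x_def y_def u'_def v'_def, folded \<sigma>_def f_def g_def]
  have Wp: "W > 0" using \<sigma> f g by (simp add: W)
  have "(sinh k)\<^sup>2 = u'\<^sup>2 / (f * g)" "(sinh l)\<^sup>2 = v'\<^sup>2 / (f * g)"
  proof -
    have fg: "f * g > 0" using f g by simp
    have 1: "(cosh k)\<^sup>2 = \<sigma> * (cosh e)\<^sup>2 / (f * g)" "(cosh l)\<^sup>2 = \<sigma> * (cosh b)\<^sup>2 / (f * g)"
    proof -
      have "(\<sigma> * r / sqrt W)\<^sup>2 = \<sigma> * r\<^sup>2 / (f * g)" for r
        using \<sigma> Wp by (simp add: power_divide power_mult_distrib W power2_eq_square[of \<sigma>])
      then show "(cosh k)\<^sup>2 = \<sigma> * (cosh e)\<^sup>2 / (f * g)" "(cosh l)\<^sup>2 = \<sigma> * (cosh b)\<^sup>2 / (f * g)"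
        by (simp_all only: k l \<sigma>_def[symmetric])
    qed
    show "(sinh k)\<^sup>2 = u'\<^sup>2 / (f * g)" "(sinh l)\<^sup>2 = v'\<^sup>2 / (f * g)"
      using 1 cosh_square_eq[of k] cosh_square_eq[of l] f g ids(2,3) by (simp_all add: diff_divide_distrib)
  qed
  \<comment> \<open>The squares fix the product only up to sign. The sign comes from
    \<open>u\<close> and \<open>v\<close> being nonnegative: neither foot lies beyond the line of
    the other side.\<close>
  then have "(sinh k * sinh l)\<^sup>2 = (u' * v' / (f * g))\<^sup>2"
    by (simp add: power_mult_distrib power_divide power2_eq_square[of f] power2_eq_square[of g] mult.assoc mult.left_commute)
  moreover have "u' * v' / (f * g) \<ge> 0" using u v f g by (simp add: u'_def v'_def)
  ultimately have sh: "sinh k * sinh l = u' * v' / (f * g)"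
    using kl by (subst (asm) power2_eq_iff_nonneg) auto
  have "cosh k * cosh l = \<sigma>\<^sup>2 * y / (sqrt W * sqrt W)"
    unfolding k l \<sigma>_def[symmetric] y_def by (simp add: power2_eq_square[of \<sigma>])
  also have "\<dots> = \<sigma> * y / (f * g)" using Wp \<sigma> by (simp add: W power2_eq_square)
  finally have "cosh (k + l) = (\<sigma> * y + u' * v') / (f * g)"
    by (simp add: cosh_add sh add_divide_distrib)
  also have "\<dots> = (y - \<kappa> * (1 - x)) / g" using f by (simp add: ids(1))
  finally have "X * g \<le> y - \<kappa> * (1 - x)" using X g by (simp add: pos_le_divide_eq)
  then show ?thesis by (simp add: g_def mult.commute)
qed

section \<open>Convex chains\<close>

text \<open>A periodic sequence over all naturals replaces indices modulo \<open>n\<close>: any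
  window of \<open>n\<close> consecutive indices lists the vertices in boundary order, and chains
  may run past \<open>n\<close>.\<close>

locale convex_cycle =
  fixes w :: "nat \<Rightarrow> hpt" and n :: nat
  assumes n_ge_3: "n \<ge> 3"
    and periodic: "w (k + n) = w k"
    and hpoint_w: "hpoint (w k)"
    and edge_pos: "2 \<le> m \<Longrightarrow> m < n \<Longrightarrow> orient (w k) (w (Suc k)) (w (k + m)) > 0"
begin

lemma orient_consecutive:
  assumes "a < b" "Suc b < a + n"
  shows "orient (w a) (w b) (w (Suc b)) > 0"
proof -
  \<comment> \<open>Seen from \<open>b\<close>, the vertex \<open>w a\<close> comes one period
    later, at index \<open>a + n\<close>.\<close>
  have "orient (w b) (w (Suc b)) (w (b + (a + n - b))) > 0"
    using assms by (intro edge_pos) auto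
  then show ?thesis
    using assms by (simp add: periodic orient_rotate[of "w a"])
qed

lemma orient_first:
  assumes "Suc a < c" "c < a + n"
  shows "orient (w a) (w (Suc a)) (w c) > 0"
  using edge_pos[of "c - a" a] assms by simp

text \<open>From edges to arbitrary triples: \<open>c\<close> advances one vertex at a time by
  \<open>orient_trans\<close>, with the first edge out of \<open>w a\<close> as reference, since the
  rest of the window lies to its left.\<close>

lemma orient_pos:
  assumes "a < b" "b < c" "c < a + n"
  shows "orient (w a) (w b) (w c) > 0"
  using assms(2,3)
proof (induction c rule: less_induct)
  case (less c)
  show ?case
  proof (cases "c = Suc b")
    case True
    with assms(1) less.prems show ?thesis by (simp add: orient_consecutive)
  next
    case False
    then obtain d where d: "c = Suc d" "b < d" using less.prems by (cases c) auto
    show ?thesis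
    proof (rule orient_trans)
      show "orient (w a) (w (Suc a)) (w b) \<ge> 0"
        using orient_first[of a b] assms(1) d less.prems by (cases "b = Suc a") auto
      show "orient (w a) (w (Suc a)) (w d) > 0" "orient (w a) (w (Suc a)) (w c) > 0"
        using orient_first[of a] assms(1) d less.prems by auto
      show "orient (w a) (w b) (w d) > 0" using less.IH[of d] d less.prems by simp
      show "orient (w a) (w d) (w c) > 0" using orient_consecutive[of a d] assms(1) d less.prems by simp
    qed
  qed
qed

lemma orient_nonneg:
  assumes "a \<le> b" "b \<le> c" "c \<le> a + n"
  shows "orient (w a) (w b) (w c) \<ge> 0"
  using orient_pos[of a b c] assms periodic[of a]
  by (cases "a = b \<or> b = c \<or> c = a + n") auto

lemma w_neq: "a < b \<Longrightarrow> b < a + n \<Longrightarrow> w a \<noteq> w b"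
proof
  assume ab: "a < b" "b < a + n" and eq: "w a = w b"
  show False
  proof (cases "Suc b < a + n")
    case True
    then show False using orient_pos[of a b "Suc b"] ab eq by simp
  next
    case False
    then have "a < Suc a" "Suc a < b" using ab n_ge_3 by auto
    then show False using orient_pos[of a "Suc a" b] ab eq by simp
  qed
qed

text \<open>The second edge is prolonged up to the line of the last one; the triangle inequality absorbs
  the corner cut off, and the chain loses an edge.\<close>

lemma convex_chain_length:
  assumes "Suc (Suc (k + m)) < k + n"
    and "hpoint x" "hpoint p"
    and "T \<in> closed_segment (w (Suc k + m)) (w (Suc (Suc k + m)))"
    and "w (Suc k) \<in> closed_segment x p"
    and "p = w (Suc k) + \<tau> *\<^sub>R (w (Suc k) - w k)" "\<tau> \<ge> 0"
    and "p = w (Suc k + m) - \<sigma> *\<^sub>R (w (Suc (Suc k + m)) - w (Suc k + m))" "\<sigma> \<ge> 0"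
  shows "hdist x (w (Suc k)) + (\<Sum>l<m. hdist (w (Suc k + l)) (w (Suc (Suc k + l))))
      + hdist (w (Suc k + m)) T \<le> hdist x p + hdist p T"
  using assms
proof (induction m arbitrary: k x p \<tau> \<sigma>)
  case 0
  have "hdist x p = hdist x (w (Suc k)) + hdist (w (Suc k)) p"
    using "0.prems"(2,3,5) by (rule hdist_segment)
  moreover have "hpoint T" using 0 hpoint_w by (auto intro: hpoint_segment)
  then have "hdist (w (Suc k)) T \<le> hdist (w (Suc k)) p + hdist p T"
    using 0 hpoint_w by (intro hdist_triangle)
  ultimately show ?case by simp
next
  case (Suc m)
  define A B C D where "A = w (Suc k)" and "B = w (Suc (Suc k))"
    and "C = w (Suc k + Suc m)" and "D = w (Suc (Suc k + Suc m))"
  define d d' f where "d = A - w k" and "d' = B - A" and "f = D - C"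
  have pA: "p = A + \<tau> *\<^sub>R d" and pC: "p = C - \<sigma> *\<^sub>R f"
    using Suc.prems by (simp_all add: A_def d_def C_def D_def f_def)
  have T: "T \<in> closed_segment C D" using Suc.prems by (simp add: C_def D_def)
  have bound: "Suc (Suc (Suc (k + m))) < k + n" using Suc.prems by simp
  have F1: "cross2 f (A - C) > 0"
  proof -
    have "orient A C D > 0"
      unfolding A_def C_def D_def using bound by (intro orient_pos) auto
    then show ?thesis using orient_rotate[of A C D] by (simp add: f_def orient_def)
  qed
  have F2: "cross2 f (B - C) \<ge> 0"
  proof -
    have "orient B C D \<ge> 0"
      unfolding B_def C_def D_def using bound by (intro orient_nonneg) auto
    then show ?thesis using orient_rotate[of B C D] by (simp add: f_def orient_def)
  qed
  have turn: "cross2 d d' > 0"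
  proof -
    have "orient (w k) (w (Suc k)) (w (Suc (Suc k))) > 0"
      using bound by (intro orient_pos) auto
    then show ?thesis by (simp add: A_def B_def d_def d'_def orient_def cross2_def algebra_simps)
  qed
  have AC: "cross2 d' (C - A) \<ge> 0"
  proof -
    have "orient (w (Suc k)) (w (Suc (Suc k))) (w (Suc k + Suc m)) \<ge> 0"
      using bound by (intro orient_nonneg) auto
    then show ?thesis by (simp add: A_def B_def C_def d'_def orient_def)
  qed
  \<comment> \<open>Reaching \<open>p\<close> from both ends expresses \<open>C - A\<close> through
    the first and last edge directions. Crossing it with \<open>f\<close> and with \<open>d'\<close>
    shows that \<tau>, \<sigma> and the turn from \<open>d'\<close> to \<open>f\<close> are
    positive.\<close>
  have CA: "C - A = \<tau> *\<^sub>R d + \<sigma> *\<^sub>R f" using pA pC by (simp add: algebra_simps)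
  have "cross2 f (A - C) = \<tau> * cross2 d f"
  proof -
    have "cross2 f (A - C) = - cross2 f (C - A)" by (simp add: cross2_def algebra_simps)
    then show ?thesis by (simp add: CA) (simp add: cross2_def algebra_simps)
  qed
  with F1 Suc.prems have \<tau>: "\<tau> > 0" by (cases "\<tau> = 0") auto
  have "cross2 d' (C - A) = \<sigma> * cross2 d' f - \<tau> * cross2 d d'"
    by (simp add: CA) (simp add: cross2_def algebra_simps)
  with AC have "\<sigma> * cross2 d' f \<ge> \<tau> * cross2 d d'" by simp
  moreover have "\<tau> * cross2 d d' > 0" using \<tau> turn by simp
  ultimately have "\<sigma> * cross2 d' f > 0" by linarith
  then have turn': "cross2 d' f > 0" and \<sigma>: "\<sigma> > 0"
    using Suc.prems by (auto simp: zero_less_mult_iff)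
  \<comment> \<open>\<tau>' is the parameter at which the ray from \<open>A\<close> through
    \<open>B\<close> meets the line of the last edge. That point \<open>p'\<close> takes the role of
    \<open>p\<close> in the induction hypothesis.\<close>
  define \<tau>' where "\<tau>' = cross2 f (B - C) / cross2 d' f"
  define p' where "p' = B + \<tau>' *\<^sub>R d'"
  have \<tau>': "\<tau>' \<ge> 0" using F2 turn' by (simp add: \<tau>'_def)
  have "cross2 f (p' - C) = cross2 f (B - C) - \<tau>' * cross2 d' f"
    by (simp add: p'_def cross2_def algebra_simps)
  then have "cross2 f (p' - C) = 0" using turn' by (simp add: \<tau>'_def)
  moreover have "f \<noteq> 0" using turn' by (auto simp: cross2_def)
  ultimately obtain c where "p' - C = c *\<^sub>R f" by (rule cross2_eq_0_obtains)
  then obtain \<sigma>' where \<sigma>'_eq: "p' = C - \<sigma>' *\<^sub>R f"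
    by (metis add.commute diff_add_cancel diff_minus_eq_add scaleR_minus_left)
  have "\<sigma>' * cross2 d' f = cross2 d' (C - p')" by (simp add: \<sigma>'_eq) (simp add: cross2_def algebra_simps)
  also have "\<dots> = cross2 d' (C - A)" by (simp add: p'_def d'_def cross2_def algebra_simps)
  finally have "\<sigma>' * cross2 d' f \<ge> 0" using AC by simp
  then have \<sigma>': "\<sigma>' \<ge> 0" using turn' by (simp add: zero_le_mult_iff)
  have "(\<sigma> - \<sigma>') * cross2 d' f = cross2 d' (p' - p)"
    by (simp add: \<sigma>'_eq pC) (simp add: cross2_def algebra_simps)
  also have "\<dots> = \<tau> * cross2 d d'" by (simp add: p'_def pA d'_def cross2_def algebra_simps)
  finally have "(\<sigma> - \<sigma>') * cross2 d' f > 0" using \<tau> turn by simp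
  then have \<sigma>\<sigma>': "\<sigma>' < \<sigma>" using turn' by (simp add: zero_less_mult_iff)
  obtain \<rho> where \<rho>: "0 \<le> \<rho>" "T = C + \<rho> *\<^sub>R f"
    using T by (auto simp: in_segment f_def algebra_simps)
  \<comment> \<open>On the line of the last edge the order is \<open>p\<close>, \<open>p'\<close>,
    \<open>C\<close>, \<open>T\<close>, because \<open>\<sigma> > \<sigma>' \<ge> 0\<close> and
    \<open>\<rho> \<ge> 0\<close>.\<close>
  have p'_seg: "p' \<in> closed_segment p T"
  proof -
    have pos: "\<sigma> + \<rho> > 0" using \<sigma> \<rho> by simp
    define u where "u = (\<sigma> - \<sigma>') / (\<sigma> + \<rho>)"
    have "0 \<le> u" "u \<le> 1" using pos \<sigma>\<sigma>' \<sigma>' \<rho> by (auto simp: u_def)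
    moreover have "p' = (1 - u) *\<^sub>R p + u *\<^sub>R T"
    proof -
      have "(1 - u) *\<^sub>R p + u *\<^sub>R T = C - (\<sigma> - u * (\<sigma> + \<rho>)) *\<^sub>R f"
        by (simp add: pC \<rho> algebra_simps)
      also have "\<dots> = p'" using pos by (simp add: u_def \<sigma>'_eq)
      finally show ?thesis by simp
    qed
    ultimately show ?thesis by (auto simp: in_segment)
  qed
  have hT: "hpoint T" using T hpoint_w by (auto simp: C_def D_def intro: hpoint_segment)
  have hp': "hpoint p'" using p'_seg hT Suc.prems by (auto intro: hpoint_segment)
  have B_seg: "B \<in> closed_segment A p'"
  proof -
    define u where "u = 1 / (1 + \<tau>')"
    have "0 \<le> u" "u \<le> 1" using \<tau>' by (auto simp: u_def)
    moreover have "B = (1 - u) *\<^sub>R A + u *\<^sub>R p'"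
    proof -
      have "(1 - u) *\<^sub>R A + u *\<^sub>R p' = A + (u * (1 + \<tau>')) *\<^sub>R d'"
        by (simp add: p'_def d'_def algebra_simps)
      also have "\<dots> = B" using \<tau>' by (simp add: u_def d'_def)
      finally show ?thesis by simp
    qed
    ultimately show ?thesis by (auto simp: in_segment)
  qed
  have "hdist (w (Suc k)) (w (Suc (Suc k))) + (\<Sum>l<m. hdist (w (Suc (Suc k) + l)) (w (Suc (Suc (Suc k) + l))))
      + hdist (w (Suc (Suc k) + m)) T \<le> hdist (w (Suc k)) p' + hdist p' T"
  proof (rule Suc.IH)
    show "Suc (Suc (Suc k + m)) < Suc k + n" using Suc.prems by simp
    show "p' = w (Suc (Suc k)) + \<tau>' *\<^sub>R (w (Suc (Suc k)) - w (Suc k))"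
      by (simp add: p'_def d'_def A_def B_def)
    show "p' = w (Suc (Suc k) + m) - \<sigma>' *\<^sub>R (w (Suc (Suc (Suc k) + m)) - w (Suc (Suc k) + m))"
      using \<sigma>'_eq by (simp add: f_def C_def D_def)
  qed (use T B_seg hp' hpoint_w \<tau>' \<sigma>' in \<open>simp_all add: A_def B_def C_def D_def\<close>)
  moreover have "(\<Sum>l<Suc m. hdist (w (Suc k + l)) (w (Suc (Suc k + l))))
      = hdist (w (Suc k)) (w (Suc (Suc k))) + (\<Sum>l<m. hdist (w (Suc (Suc k) + l)) (w (Suc (Suc (Suc k) + l))))"
    by (subst sum.lessThan_Suc_shift) simp
  moreover have "hdist (w (Suc k)) p' \<le> hdist (w (Suc k)) p + hdist p p'"
    using hpoint_w hp' Suc.prems by (intro hdist_triangle)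
  moreover have "hdist p T = hdist p p' + hdist p' T"
    using p'_seg hT Suc.prems by (intro hdist_segment)
  moreover have "hdist x p = hdist x (w (Suc k)) + hdist (w (Suc k)) p"
    using Suc.prems(2,3,5) by (rule hdist_segment)
  ultimately show ?case by simp
qed

end

section \<open>Crossing heights\<close>

text \<open>\<open>P\<close> solves the two linear conditions of orthogonality to the side normals,
  scaled so that no denominators occur. Where it is timelike, its normalisation is the meeting point
  of the side lines; the other products put it on the sheet of \<open>Q\<close> and give its
  distances from the feet.\<close>

lemma meeting_vector:
  fixes b e :: real
  assumes Q: "mink Q Q = -1" and E: "mink Q E = 0" "mink E E = 1"
    and G: "mink Q G = 0" "mink G G = 1"
  defines "\<kappa> \<equiv> - mink E G"
  defines "x \<equiv> sinh b * sinh e" and "y \<equiv> cosh b * cosh e"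
    and "u \<equiv> sinh e * cosh b + \<kappa> * (sinh b * cosh e)"
    and "v \<equiv> sinh b * cosh e + \<kappa> * (sinh e * cosh b)"
  defines "P \<equiv> ((1 - \<kappa>\<^sup>2) * y) *\<^sub>R Q - v *\<^sub>R E - u *\<^sub>R G"
  shows "mink P P = - ((1 - \<kappa>\<^sup>2) * ((1 + x + y * \<kappa>) * (1 - x - y * \<kappa>)))"
    and "mink P Q = - ((1 - \<kappa>\<^sup>2) * y)"
    and "mink P (cosh b *\<^sub>R Q - sinh b *\<^sub>R E) = - ((1 - \<kappa>\<^sup>2) * cosh e)"
    and "mink P (cosh e *\<^sub>R Q - sinh e *\<^sub>R G) = - ((1 - \<kappa>\<^sup>2) * cosh b)"
    and "mink P (cosh b *\<^sub>R E - sinh b *\<^sub>R Q) = 0"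
    and "mink P (cosh e *\<^sub>R G - sinh e *\<^sub>R Q) = 0"
proof -
  define p q r s where "p = sinh b" and "q = cosh b" and "r = sinh e" and "s = cosh e"
  have q: "q * q = 1 + p * p" and s: "s * s = 1 + r * r"
    using cosh_square_eq[of b] cosh_square_eq[of e] by (simp_all add: p_def q_def r_def s_def power2_eq_square)
  have EG: "mink E G = - \<kappa>" "mink G E = - \<kappa>" by (simp_all add: \<kappa>_def mink_commute)
  note comm = E(1) G(1) E(1)[unfolded mink_commute[of Q]] G(1)[unfolded mink_commute[of Q]]
  have PQ: "mink P Q = - ((1 - \<kappa>\<^sup>2) * y)"
    and PE: "mink P E = - v + \<kappa> * u" and PG: "mink P G = - u + \<kappa> * v"
    by (simp_all add: P_def Q E(2) G(2) EG comm)
  then show "mink P Q = - ((1 - \<kappa>\<^sup>2) * y)" by simp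
  have PP: "mink P P = (1 - \<kappa>\<^sup>2) * y * mink P Q - v * mink P E - u * mink P G"
    by (subst (2) P_def) simp
  note defs = u_def v_def x_def y_def p_def[symmetric] q_def[symmetric] r_def[symmetric] s_def[symmetric] power2_eq_square
  show "mink P P = - ((1 - \<kappa>\<^sup>2) * ((1 + x + y * \<kappa>) * (1 - x - y * \<kappa>)))"
    unfolding PP PQ PE PG defs using q s by algebra
  show "mink P (cosh b *\<^sub>R Q - sinh b *\<^sub>R E) = - ((1 - \<kappa>\<^sup>2) * cosh e)"
    unfolding mink_linear PQ PE PG defs using q s by algebra
  show "mink P (cosh e *\<^sub>R Q - sinh e *\<^sub>R G) = - ((1 - \<kappa>\<^sup>2) * cosh b)"
    unfolding mink_linear PQ PE PG defs using q s by algebra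
  show "mink P (cosh b *\<^sub>R E - sinh b *\<^sub>R Q) = 0"
    unfolding mink_linear PQ PE PG defs by (simp add: algebra_simps)
  show "mink P (cosh e *\<^sub>R G - sinh e *\<^sub>R Q) = 0"
    unfolding mink_linear PQ PE PG defs by (simp add: algebra_simps)
qed

lemma orient_middle_pos:
  assumes "x \<in> open_segment c d" "orient a c b \<ge> 0" "orient a d b \<ge> 0"
    and "orient a c b > 0 \<or> orient a d b > 0"
  shows "orient a x b > 0"
  using orient_open_segment_pos[of x c d b a] assms by (metis orient_rotate)

lemma orient_middle_nonneg:
  assumes "x \<in> closed_segment c d" "orient a c b \<ge> 0" "orient a d b \<ge> 0"
  shows "orient a x b \<ge> 0"
  using orient_closed_segment_nonneg[of x c d b a] assms by (metis orient_rotate)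

lemma in_segment_of_opposite:
  fixes A d :: "'a::real_vector"
  assumes "r \<ge> 0" "s \<ge> 0" "x = A - r *\<^sub>R d" "y = A + s *\<^sub>R d"
  shows "A \<in> closed_segment x y"
proof (cases "r + s = 0")
  case True
  then have "r = 0" "s = 0" using assms by auto
  then show ?thesis using assms by simp
next
  case False
  then have rs: "r + s > 0" using assms by simp
  define u where "u = r / (r + s)"
  have "0 \<le> u" "u \<le> 1" using rs assms by (auto simp: u_def)
  moreover have "A = (1 - u) *\<^sub>R x + u *\<^sub>R y"
  proof -
    have "(1 - u) *\<^sub>R x + u *\<^sub>R y = A + (u * (r + s) - r) *\<^sub>R d"
      by (simp add: assms algebra_simps)
    then show ?thesis using rs by (simp add: u_def)
  qed
  ultimately show ?thesis by (auto simp: in_segment)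
qed

text \<open>The equation \<open>height\<close> says at once that \<open>t k\<close> is the foot of
  the perpendicular from \<open>w k\<close> and that its length is \<Delta>. As
  \<open>n = 2 * h + 1\<close>, the side opposite \<open>w k\<close> starts at
  \<open>w (k + h)\<close>.\<close>

locale star_polygon = convex_cycle w n for w :: "nat \<Rightarrow> hpt" and n :: nat +
  fixes t :: "nat \<Rightarrow> hpt" and h :: nat and \<Delta> :: real
  assumes n_eq: "n = Suc (2 * h)"
    and t_periodic: "t (k + n) = t k"
    and foot_in_side: "t k \<in> open_segment (w (k + h)) (w (Suc (k + h)))"
    and \<Delta>_pos: "\<Delta> > 0"
    and height: "lift (w k) = cosh \<Delta> *\<^sub>R lift (t k) + sinh \<Delta> *\<^sub>R normal (w (k + h)) (w (Suc (k + h)))"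
begin

lemma h_pos: "h \<ge> 1"
  using n_ge_3 n_eq by simp

lemma foot_in_closed_side: "t k \<in> closed_segment (w (k + h)) (w (Suc (k + h)))"
  using foot_in_side by (simp add: open_segment_def)

lemma hpoint_t: "hpoint (t k)"
  using hpoint_segment[OF hpoint_w hpoint_w foot_in_closed_side] .

lemma w_Suc_neq: "w k \<noteq> w (Suc k)"
  using w_neq[of k "Suc k"] n_ge_3 by simp

lemma w_periodic_mult: "w (k + n * j) = w k"
proof (induction j)
  case (Suc j)
  have "w (k + n * Suc j) = w ((k + n * j) + n)" by (simp add: algebra_simps)
  then show ?case using Suc periodic by simp
qed simp

lemma edge_nonneg: "orient (w k) (w (Suc k)) (w m) \<ge> 0"
proof -
  \<comment> \<open>Adding \<open>n * k\<close>, a multiple of the period, keeps the subtraction of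
    \<open>k\<close> from truncating.\<close>
  define q r where "q = m + n * k - k" and "r = q mod n"
  have "k \<le> n * k" using n_ge_3 by simp
  then have "m + n * k = k + q" unfolding q_def by linarith
  then have "m + n * k = (k + r) + n * (q div n)" by (simp add: r_def)
  then have "w m = w (k + r)" using w_periodic_mult by metis
  moreover have "r < n" using n_ge_3 by (simp add: r_def)
  ultimately show ?thesis
    using orient_nonneg[of k "Suc k" "k + r"] by (cases "r = 0") auto
qed

lemma edge_foot_nonneg: "orient (w k) (w (Suc k)) (t m) \<ge> 0"
  using orient_closed_segment_nonneg[OF foot_in_closed_side] edge_nonneg by blast

lemma side_foot_collinear: "orient (w (k + h)) (w (Suc (k + h))) (t k) = 0"
  using foot_in_closed_side[of k] by (auto simp: in_segment orient_segment)

section \<open>Congruent right triangles and boundary arcs\<close>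

lemma Pythagoras:
  assumes "hpoint x" "orient (w (k + h)) (w (Suc (k + h))) x = 0"
  shows "cosh (hdist (w k) x) = cosh \<Delta> * cosh (hdist (t k) x)"
proof -
  have "mink (normal (w (k + h)) (w (Suc (k + h)))) (lift x) = 0"
    using mink_normal_lift_iff(4)[OF hpoint_w w_Suc_neq assms(1)] assms(2) by simp
  then show ?thesis using assms hpoint_w hpoint_t by (simp add: cosh_hdist height)
qed

text \<open>The triangles with right angles at \<open>t k\<close> and at \<open>t l\<close> share
  the hypotenuse from \<open>w k\<close> to \<open>w l\<close>, and each has one leg
  \<Delta>.\<close>

lemma legs_eq:
  assumes x: "orient (w (k + h)) (w (Suc (k + h))) (w l) = 0"
    and y: "orient (w (l + h)) (w (Suc (l + h))) (w k) = 0"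
  shows "hdist (w k) (t l) = hdist (t k) (w l)"
proof -
  have "cosh \<Delta> * cosh (hdist (t k) (w l)) = cosh \<Delta> * cosh (hdist (t l) (w k))"
    using Pythagoras[OF hpoint_w x] Pythagoras[OF hpoint_w y] by (simp add: hdist_commute)
  then have "cosh (hdist (t k) (w l)) = cosh (hdist (w k) (t l))"
    by (simp add: hdist_commute)
  then show ?thesis
    using arcosh_cosh_real hdist_nonneg hpoint_w hpoint_t by metis
qed

text \<open>The foot of the height from \<open>w (Suc (k + h))\<close> splits the side from
  \<open>w k\<close> to \<open>w (Suc k)\<close>. Each piece is a leg that \<open>legs_eq\<close>
  exchanges for one ending at \<open>w (Suc (k + h))\<close>.\<close>

lemma side_length:
  "hdist (w k) (w (Suc k)) =
    hdist (t k) (w (Suc (k + h))) + hdist (w (Suc (k + h))) (t (Suc k))"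
proof -
  have idx: "w (Suc (k + h) + h) = w k" "w (Suc (Suc (k + h) + h)) = w (Suc k)"
    using periodic[of k] periodic[of "Suc k"] by (simp_all add: n_eq mult_2 add.assoc)
  have "t (Suc (k + h)) \<in> closed_segment (w k) (w (Suc k))"
    using foot_in_closed_side[of "Suc (k + h)"] by (simp only: idx)
  then have "hdist (w k) (w (Suc k)) = hdist (w k) (t (Suc (k + h))) + hdist (t (Suc (k + h))) (w (Suc k))"
    by (intro hdist_segment hpoint_w)
  moreover have "hdist (w k) (t (Suc (k + h))) = hdist (t k) (w (Suc (k + h)))"
    by (rule legs_eq; simp only: idx orient_same)
  moreover have "hdist (w (Suc k)) (t (Suc (k + h))) = hdist (t (Suc k)) (w (Suc (k + h)))"
  proof (rule legs_eq)
    show "orient (w (Suc k + h)) (w (Suc (Suc k + h))) (w (Suc (k + h))) = 0" by simp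
    show "orient (w (Suc (k + h) + h)) (w (Suc (Suc (k + h) + h))) (w (Suc k)) = 0"
      by (simp only: idx orient_same)
  qed
  ultimately show ?thesis by (simp add: hdist_commute)
qed

text \<open>The right-hand side is the length of the boundary arc between the feet, which equals the
  arc from \<open>w i\<close> to \<open>w (i + Suc m)\<close> by the congruence of the right triangles.\<close>

lemma arc_le:
  "hdist (w i) (w (i + Suc m)) \<le> hdist (t i) (w (Suc (i + h)))
    + (\<Sum>l<m. hdist (w (Suc (i + h) + l)) (w (Suc (Suc (i + h) + l)))) + hdist (w (Suc (i + h) + m)) (t (i + Suc m))"
proof (induction m)
  case 0
  then show ?case by (simp add: side_length)
next
  case (Suc m)
  have "hdist (w i) (w (i + Suc (Suc m))) \<le> hdist (w i) (w (i + Suc m)) + hdist (w (i + Suc m)) (w (Suc (i + Suc m)))"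
    using hdist_triangle hpoint_w by simp
  moreover have "hdist (w (i + Suc m)) (w (Suc (i + Suc m))) =
    hdist (t (i + Suc m)) (w (Suc (i + Suc m + h))) + hdist (w (Suc (i + Suc m + h))) (t (Suc (i + Suc m)))"
    by (rule side_length)
  moreover have "hdist (w (i + Suc m + h)) (w (Suc (i + Suc m + h))) =
    hdist (w (i + Suc m + h)) (t (i + Suc m)) + hdist (t (i + Suc m)) (w (Suc (i + Suc m + h)))"
    using foot_in_closed_side by (intro hdist_segment hpoint_w)
  moreover have "i + Suc m + h = Suc (i + h) + m" by simp
  ultimately show ?case using Suc by (simp add: add.assoc add.commute[of m h])
qed

text \<open>\<open>E\<close> is the unit tangent of the height at \<open>p\<close>, pointing towards
  \<open>w k\<close>, and \<open>a\<close>, \<open>b\<close> are the distances from \<open>p\<close>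
  to the two ends. The side normal is the same tangent moved along the height to the foot.\<close>

lemma height_frame:
  assumes "p \<in> closed_segment (w k) (t k)"
  obtains a b E where "a \<ge> 0" "b \<ge> 0" "a + b = \<Delta>"
    "lift (w k) = cosh a *\<^sub>R lift p + sinh a *\<^sub>R E"
    "lift (t k) = cosh b *\<^sub>R lift p - sinh b *\<^sub>R E"
    "normal (w (k + h)) (w (Suc (k + h))) = cosh b *\<^sub>R E - sinh b *\<^sub>R lift p"
    "mink (lift p) E = 0" "mink E E = 1"
proof -
  define N where "N = normal (w (k + h)) (w (Suc (k + h)))"
  have NN: "mink N N = 1" unfolding N_def by (rule mink_normal_self[OF hpoint_w w_Suc_neq])
  have NT: "mink N (lift (t k)) = 0" "mink (lift (t k)) N = 0"
    using mink_normal_lift_iff(4)[OF hpoint_w w_Suc_neq hpoint_t] side_foot_collinear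
    by (simp_all add: N_def mink_commute)
  have TT: "mink (lift (t k)) (lift (t k)) = -1" by (rule mink_lift_self[OF hpoint_t])
  have hgt: "lift (w k) = cosh \<Delta> *\<^sub>R lift (t k) + sinh \<Delta> *\<^sub>R N" by (simp add: height N_def)
  obtain \<alpha> \<beta> where ab: "\<alpha> \<ge> 0" "\<beta> \<ge> 0" "lift p = \<alpha> *\<^sub>R lift (w k) + \<beta> *\<^sub>R lift (t k)"
    using lift_in_segment[OF hpoint_w hpoint_t assms] by blast
  define c s where "c = \<alpha> * cosh \<Delta> + \<beta>" and "s = \<alpha> * sinh \<Delta>"
  have P: "lift p = c *\<^sub>R lift (t k) + s *\<^sub>R N" by (simp add: ab hgt c_def s_def algebra_simps)
  have "mink (lift p) (lift p) = -1"
    by (rule mink_lift_self[OF hpoint_segment[OF hpoint_w hpoint_t assms]])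
  then have cs: "c\<^sup>2 = 1 + s\<^sup>2" by (simp add: P NN NT TT power2_eq_square algebra_simps)
  have c0: "c \<ge> 0" and s0: "s \<ge> 0" using ab \<Delta>_pos by (simp_all add: c_def s_def)
  define b where "b = arsinh s"
  have sb: "s = sinh b" by (simp add: b_def sinh_arsinh_real)
  have "c\<^sup>2 = (cosh b)\<^sup>2" using cs by (simp add: sb cosh_square_eq)
  then have cb: "c = cosh b" using c0 by (subst (asm) power2_eq_iff_nonneg) auto
  have b0: "b \<ge> 0" using s0 by (simp add: sb)
  \<comment> \<open>Together with \<open>c\<^sup>2 = 1 + s\<^sup>2\<close> this bounds \<alpha> by
    1, so \<open>p\<close> is no farther from the foot than \<open>w k\<close> is.\<close>
  have "(\<alpha> * cosh \<Delta>)\<^sup>2 \<le> c\<^sup>2" using ab by (intro power_mono) (auto simp: c_def)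
  then have "\<alpha>\<^sup>2 \<le> 1" by (simp add: cs s_def power_mult_distrib cosh_square_eq algebra_simps)
  then have "\<alpha> \<le> 1" using ab by (simp add: abs_square_le_1)
  then have "s \<le> 1 * sinh \<Delta>" unfolding s_def using \<Delta>_pos by (intro mult_right_mono) auto
  then have b\<Delta>: "b \<le> \<Delta>" by (simp add: sb)
  define E where "E = sinh b *\<^sub>R lift (t k) + cosh b *\<^sub>R N"
  have sq: "(cosh b)\<^sup>2 = 1 + (sinh b)\<^sup>2" by (simp add: cosh_square_eq)
  have P': "lift p = cosh b *\<^sub>R lift (t k) + sinh b *\<^sub>R N" using P by (simp add: sb cb)
  show ?thesis
  proof (rule that[of "\<Delta> - b" b E])
    have *: "cosh (\<Delta> - b) * cosh b + sinh (\<Delta> - b) * sinh b = cosh \<Delta>"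
      "cosh (\<Delta> - b) * sinh b + sinh (\<Delta> - b) * cosh b = sinh \<Delta>"
      using cosh_add[of "\<Delta> - b" b] sinh_add[of "\<Delta> - b" b] by simp_all
    have "cosh (\<Delta> - b) *\<^sub>R lift p + sinh (\<Delta> - b) *\<^sub>R E =
      (cosh (\<Delta> - b) * cosh b + sinh (\<Delta> - b) * sinh b) *\<^sub>R lift (t k)
        + (cosh (\<Delta> - b) * sinh b + sinh (\<Delta> - b) * cosh b) *\<^sub>R N"
      by (simp add: P' E_def algebra_simps)
    then show "lift (w k) = cosh (\<Delta> - b) *\<^sub>R lift p + sinh (\<Delta> - b) *\<^sub>R E"
      by (simp only: * hgt)
    have "cosh b *\<^sub>R lift p - sinh b *\<^sub>R E = ((cosh b)\<^sup>2 - (sinh b)\<^sup>2) *\<^sub>R lift (t k)"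
      by (simp add: P' E_def power2_eq_square algebra_simps)
    then show "lift (t k) = cosh b *\<^sub>R lift p - sinh b *\<^sub>R E" by (simp add: sq)
    have "cosh b *\<^sub>R E - sinh b *\<^sub>R lift p = ((cosh b)\<^sup>2 - (sinh b)\<^sup>2) *\<^sub>R N"
      by (simp add: P' E_def power2_eq_square algebra_simps)
    then show "normal (w (k + h)) (w (Suc (k + h))) = cosh b *\<^sub>R E - sinh b *\<^sub>R lift p"
      by (simp add: sq N_def)
    show "mink (lift p) E = 0" by (simp add: P' E_def NN NT TT)
    show "mink E E = 1" using sq by (simp add: E_def NN NT TT power2_eq_square)
  qed (use b0 b\<Delta> in auto)
qed

text \<open>\<open>arc_le\<close> replaces the chord by the arc between the feet, and
  \<open>convex_chain_length\<close> the arc by the two tangents from \<open>p\<close>. The latter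
  requires \<open>p\<close> to lie beyond the end of the first side and before the start of the
  last; \<open>ahead\<close> excludes lines that meet on the wrong side of the height.\<close>

lemma hdist_le_via_meeting_point:
  assumes m: "Suc m \<le> h" and p: "hpoint p"
    and on_i: "orient (w (i + h)) (w (Suc (i + h))) p = 0"
    and on_j: "orient (w (Suc (i + h) + m)) (w (Suc (Suc (i + h) + m))) p = 0"
    and ahead: "orient (w i) (t i) p \<ge> 0"
  shows "hdist (w i) (w (i + Suc m)) \<le> hdist (t i) p + hdist p (t (i + Suc m))"
proof -
  define k where "k = i + h"
  define A A' B B' where "A = w k" and "A' = w (Suc k)" and "B = w (Suc k + m)" and "B' = w (Suc (Suc k + m))"
  note defs = A_def A'_def B_def B'_def
  have n: "Suc (Suc k + m) < k + n" "Suc k < i + n" "k < i + n" "i < k"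
    using m h_pos by (auto simp: n_eq k_def)
  have neq: "A \<noteq> A'" "B \<noteq> B'" unfolding defs by (rule w_Suc_neq)+
  obtain c where c: "p = A + c *\<^sub>R (A' - A)"
    using orient_eq_0_obtains[of A A' p] on_i neq by (auto simp: defs k_def)
  obtain c' where c': "p = B + c' *\<^sub>R (B' - B)"
    using orient_eq_0_obtains[of B B' p] on_j neq by (auto simp: defs k_def)
  have pA: "p = (1 - c) *\<^sub>R A + c *\<^sub>R A'" by (simp add: c algebra_simps)
  have pB: "p = (1 - c') *\<^sub>R B + c' *\<^sub>R B'" by (simp add: c' algebra_simps)
  obtain u where u: "0 < u" "u < 1" "t i = (1 - u) *\<^sub>R A + u *\<^sub>R A'"
    using foot_in_side[of i] by (auto simp: in_segment k_def defs)
  have fA: "orient B B' A > 0"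
  proof -
    have "orient A B B' > 0" unfolding defs using n by (intro orient_pos) auto
    then show ?thesis by (simp add: orient_rotate[of A])
  qed
  have fA': "orient B B' A' \<ge> 0" by (simp only: defs edge_nonneg)
  have f: "(1 - c) * orient B B' A + c * orient B B' A' = 0"
  proof -
    have "orient B B' p = 0" using on_j by (simp add: defs k_def)
    then show ?thesis unfolding pA orient_segment .
  qed
  \<comment> \<open>A point with \<open>0 \<le> c < 1\<close> would lie strictly inside the line of
    the other side, since \<open>A\<close> does and \<open>A'\<close> is not outside. A point with
    \<open>c < 0\<close> would violate \<open>ahead\<close>.\<close>
  have c1: "c \<ge> 1"
  proof (rule ccontr)
    assume "\<not> c \<ge> 1"
    then have c1: "c < 1" by simp
    have "c < 0"
    proof (rule ccontr)
      assume "\<not> c < 0"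
      then have "c * orient B B' A' \<ge> 0" using fA' by simp
      moreover have "(1 - c) * orient B B' A > 0" using c1 fA by simp
      ultimately show False using f by linarith
    qed
    have gA': "orient (w i) (t i) A' > 0"
    proof (rule orient_middle_pos[OF foot_in_side])
      have "orient (w i) (w k) A' > 0" unfolding defs using n by (intro orient_pos) auto
      then show "0 \<le> orient (w i) (w (i + h)) A'" "0 < orient (w i) (w (i + h)) A' \<or> 0 < orient (w i) (w (Suc (i + h))) A'"
        by (simp_all add: k_def)
      show "0 \<le> orient (w i) (w (Suc (i + h))) A'" by (simp add: defs k_def)
    qed
    have "(1 - u) * orient (w i) (t i) A + u * orient (w i) (t i) A' = orient (w i) (t i) (t i)"
      by (subst (4) u(3)) (simp only: orient_segment)
    then have "(1 - u) * orient (w i) (t i) A = - (u * orient (w i) (t i) A')" by simp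
    moreover have "u * orient (w i) (t i) A' > 0" using u gA' by simp
    ultimately have "(1 - u) * orient (w i) (t i) A < 0" by linarith
    then have gA: "orient (w i) (t i) A < 0" using u by (simp add: mult_less_0_iff)
    have "orient (w i) (t i) p = (1 - c) * orient (w i) (t i) A + c * orient (w i) (t i) A'"
      unfolding pA by (rule orient_segment)
    moreover have "(1 - c) * orient (w i) (t i) A < 0" "c * orient (w i) (t i) A' < 0"
      using c1 \<open>c < 0\<close> gA gA' by (simp_all add: mult_less_0_iff)
    ultimately show False using ahead by linarith
  qed
  have hB: "orient A A' B \<ge> 0" by (simp only: defs edge_nonneg)
  have hB': "orient A A' B' > 0" unfolding defs using n by (intro orient_pos) auto
  have hp: "(1 - c') * orient A A' B + c' * orient A A' B' = 0"
  proof -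
    have "orient A A' p = 0" using on_i by (simp add: defs k_def)
    then show ?thesis unfolding pB orient_segment .
  qed
  have c'0: "c' \<le> 0"
  \<comment> \<open>For \<open>m = 0\<close> the sides share the vertex \<open>A' = B\<close>; then
    \<open>orient B B' A'\<close> vanishes and gives no sign for the turn between them.\<close>
  proof (cases m)
    case 0
    then have "B = A'" by (simp add: defs)
    then show ?thesis using hp hB' by simp
  next
    case (Suc m')
    have fA'_pos: "orient B B' A' > 0"
    proof -
      have "orient A' B B' > 0" unfolding defs using n Suc by (intro orient_pos) auto
      then show ?thesis by (simp add: orient_rotate[of A'])
    qed
    define \<theta> where "\<theta> = cross2 (A' - A) (B' - B)"
    have 1: "orient A A' B' - orient A A' B = \<theta>" "orient B B' A - orient B B' A' = \<theta>"
      by (simp_all add: \<theta>_def orient_def cross2_def algebra_simps)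
    have "(c - 1) * \<theta> = orient B B' A'" using f by (simp add: 1(2)[symmetric] algebra_simps)
    then have "(c - 1) * \<theta> > 0" using fA'_pos by simp
    then have \<theta>: "\<theta> > 0" using c1 by (simp add: zero_less_mult_iff)
    have "c' * \<theta> = - orient A A' B" using hp by (simp add: 1(1)[symmetric] algebra_simps)
    then have "c' * \<theta> \<le> 0" using hB by simp
    then show ?thesis using \<theta> by (simp add: mult_le_0_iff)
  qed
  have "hdist (t i) (w (Suc k)) + (\<Sum>l<m. hdist (w (Suc k + l)) (w (Suc (Suc k + l))))
      + hdist (w (Suc k + m)) (t (i + Suc m)) \<le> hdist (t i) p + hdist p (t (i + Suc m))"
  proof (rule convex_chain_length)
    show "Suc (Suc (k + m)) < k + n" using n by simp
    show "t (i + Suc m) \<in> closed_segment (w (Suc k + m)) (w (Suc (Suc k + m)))"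
    proof -
      have "i + Suc m + h = Suc k + m" by (simp add: k_def)
      then show ?thesis using foot_in_closed_side[of "i + Suc m"] by (simp only:)
    qed
    show "w (Suc k) \<in> closed_segment (t i) p"
      by (rule in_segment_of_opposite[of "1 - u" "c - 1" _ _ "A' - A"])
        (use u c1 in \<open>simp_all add: pA defs algebra_simps\<close>)
    show "p = w (Suc k) + (c - 1) *\<^sub>R (w (Suc k) - w k)" by (simp add: pA defs algebra_simps)
    show "p = w (Suc k + m) - (- c') *\<^sub>R (w (Suc (Suc k + m)) - w (Suc k + m))" by (simp add: c' defs)
  qed (use c1 c'0 p hpoint_t in auto)
  then show ?thesis using arc_le[of i m] by (simp add: k_def)
qed

text \<open>With \<open>j = i + Suc m\<close>, the boundary order is \<open>w i\<close>,
  \<open>w j\<close>, \<open>t i\<close>, \<open>t j\<close>, so each chord separates the ends of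
  the other. Feet are interior to their sides, hence one strictly oriented end of a side suffices;
  the other triple may degenerate, as for \<open>j = i + h\<close>.\<close>

lemma heights_cross:
  assumes m: "Suc m \<le> h"
  shows "orient (w i) (t i) (w (i + Suc m)) < 0"
    and "\<exists>p. p \<in> closed_segment (w i) (t i) \<and> p \<in> closed_segment (w (i + Suc m)) (t (i + Suc m))"
proof -
  define j where "j = i + Suc m"
  have n: "i < j" "j \<le> i + h" "h \<ge> 1" "n = Suc (2 * h)" using m h_pos by (auto simp: j_def n_eq)
  have "orient (w i) (w j) (t i) > 0"
  proof (rule orient_open_segment_pos[OF foot_in_side])
    show "orient (w i) (w j) (w (i + h)) \<ge> 0" "orient (w i) (w j) (w (Suc (i + h))) \<ge> 0"
      using n by (auto intro!: orient_nonneg)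
    have "orient (w i) (w j) (w (Suc (i + h))) > 0" using n by (intro orient_pos) auto
    then show "orient (w i) (w j) (w (i + h)) > 0 \<or> orient (w i) (w j) (w (Suc (i + h))) > 0" ..
  qed
  then have 1: "orient (w i) (t i) (w j) < 0" using orient_swap[of "w i" "t i" "w j"] by simp
  then show "orient (w i) (t i) (w (i + Suc m)) < 0" by (simp add: j_def)
  have 2: "orient (w i) (t i) (t j) > 0"
  proof (rule orient_open_segment_pos[OF foot_in_side])
    have *: "orient (w i) (t i) (w (j + h)) > 0"
    proof (rule orient_middle_pos[OF foot_in_side])
      have "orient (w i) (w (i + h)) (w (j + h)) > 0" using n by (intro orient_pos) auto
      then show "orient (w i) (w (i + h)) (w (j + h)) \<ge> 0"
        "orient (w i) (w (i + h)) (w (j + h)) > 0 \<or> orient (w i) (w (Suc (i + h))) (w (j + h)) > 0" by auto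
      show "orient (w i) (w (Suc (i + h))) (w (j + h)) \<ge> 0" using n by (intro orient_nonneg) auto
    qed
    then show "orient (w i) (t i) (w (j + h)) \<ge> 0"
      "orient (w i) (t i) (w (j + h)) > 0 \<or> orient (w i) (t i) (w (Suc (j + h))) > 0" by auto
    show "orient (w i) (t i) (w (Suc (j + h))) \<ge> 0"
      by (rule orient_middle_nonneg[OF foot_in_closed_side]) (use n in \<open>auto intro!: orient_nonneg\<close>)
  qed
  have 3: "orient (w j) (t j) (w i) > 0"
  proof -
    \<comment> \<open>In the window that starts at \<open>j\<close>, the vertex \<open>w i\<close>
      has index \<open>i + n\<close>.\<close>
    have "orient (w j) (t j) (w (i + n)) > 0"
    proof (rule orient_middle_pos[OF foot_in_side])
      have "orient (w j) (w (j + h)) (w (i + n)) > 0" using n by (intro orient_pos) auto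
      then show "orient (w j) (w (j + h)) (w (i + n)) \<ge> 0"
        "orient (w j) (w (j + h)) (w (i + n)) > 0 \<or> orient (w j) (w (Suc (j + h))) (w (i + n)) > 0" by auto
      show "orient (w j) (w (Suc (j + h))) (w (i + n)) \<ge> 0" using n by (intro orient_nonneg) auto
    qed
    then show ?thesis by (simp only: periodic)
  qed
  have "orient (w j) (t i) (t j) > 0"
  proof (rule orient_open_segment_pos[OF foot_in_side])
    have "orient (w j) (t i) (w (Suc (j + h))) > 0"
    proof (rule orient_middle_pos[OF foot_in_side])
      have "orient (w j) (w (Suc (i + h))) (w (Suc (j + h))) > 0" using n by (intro orient_pos) auto
      then show "orient (w j) (w (Suc (i + h))) (w (Suc (j + h))) \<ge> 0"
        "orient (w j) (w (i + h)) (w (Suc (j + h))) > 0 \<or> orient (w j) (w (Suc (i + h))) (w (Suc (j + h))) > 0" by auto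
      show "orient (w j) (w (i + h)) (w (Suc (j + h))) \<ge> 0" using n by (intro orient_nonneg) auto
    qed
    then show "orient (w j) (t i) (w (Suc (j + h))) \<ge> 0"
      "orient (w j) (t i) (w (j + h)) > 0 \<or> orient (w j) (t i) (w (Suc (j + h))) > 0" by auto
    show "orient (w j) (t i) (w (j + h)) \<ge> 0"
      by (rule orient_middle_nonneg[OF foot_in_closed_side]) (use n in \<open>auto intro!: orient_nonneg\<close>)
  qed
  then have 4: "orient (w j) (t j) (t i) < 0" using orient_swap[of "w j" "t j" "t i"] by simp
  obtain p where "p \<in> closed_segment (w i) (t i)" "p \<in> closed_segment (w j) (t j)"
    using 1 2 3 4 by (rule segments_cross)
  then show "\<exists>p. p \<in> closed_segment (w i) (t i) \<and> p \<in> closed_segment (w (i + Suc m)) (t (i + Suc m))"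
    by (auto simp: j_def)
qed

text \<open>In the frame \<open>Q\<close>, \<open>E\<close>, \<open>G\<close> at the crossing point,
  the ends of both heights and both side normals are explicit, so every geometric fact turns into an
  inequality in \<open>a\<close>, \<open>b\<close>, \<open>c\<close>, \<open>e\<close> and
  \<kappa>.\<close>

lemma short_chord_bound:
  assumes m: "Suc m \<le> h"
  shows "3 * (cosh (hdist (w i) (w (i + Suc m))))\<^sup>2 < (cosh \<Delta>)\<^sup>2 * ((cosh \<Delta>)\<^sup>2 + 2)"
proof -
  define j where "j = i + Suc m"
  have jh: "j + h = Suc (i + h) + m" "Suc (j + h) = Suc (Suc (i + h) + m)" by (simp_all add: j_def)
  have right: "orient (w i) (t i) (w j) < 0" using heights_cross(1)[OF m] by (simp add: j_def)
  obtain z where z: "z \<in> closed_segment (w i) (t i)" "z \<in> closed_segment (w j) (t j)"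
    using heights_cross(2)[OF m, of i] by (auto simp: j_def)
  define Q where "Q = lift z"
  have hz: "hpoint z" using hpoint_segment[OF hpoint_w hpoint_t z(1)] .
  have QQ: "mink Q Q = -1" using mink_lift_self[OF hz] by (simp add: Q_def)
  define Ni Nj where "Ni = normal (w (i + h)) (w (Suc (i + h)))" and "Nj = normal (w (j + h)) (w (Suc (j + h)))"
  obtain a b E where i: "a \<ge> 0" "b \<ge> 0" "a + b = \<Delta>" "lift (w i) = cosh a *\<^sub>R Q + sinh a *\<^sub>R E"
    "lift (t i) = cosh b *\<^sub>R Q - sinh b *\<^sub>R E" "Ni = cosh b *\<^sub>R E - sinh b *\<^sub>R Q"
    "mink Q E = 0" "mink E E = 1"
    using height_frame[OF z(1), folded Q_def Ni_def] by metis
  obtain c e G where j: "c \<ge> 0" "e \<ge> 0" "c + e = \<Delta>" "lift (w j) = cosh c *\<^sub>R Q + sinh c *\<^sub>R G"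
    "lift (t j) = cosh e *\<^sub>R Q - sinh e *\<^sub>R G" "Nj = cosh e *\<^sub>R G - sinh e *\<^sub>R Q"
    "mink Q G = 0" "mink G G = 1"
    using height_frame[OF z(2), folded Q_def Nj_def] by metis
  define \<kappa> where "\<kappa> = - mink E G"
  have EG: "mink E G = - \<kappa>" "mink G E = - \<kappa>" by (simp_all add: \<kappa>_def mink_commute)
  have EQ: "mink E Q = 0" "mink G Q = 0" using i j by (simp_all add: mink_commute)
  note M = QQ EG EQ i(7,8) j(7,8)
  define F where "F = normal (w i) (t i)"
  have "w i \<noteq> t i" using right by auto
  note Fiff = mink_normal_lift_iff[OF hpoint_w this, folded F_def]
  have FF: "mink F F = 1" unfolding F_def using hpoint_w \<open>w i \<noteq> t i\<close> by (rule mink_normal_self)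
  have "orient (w i) (t i) z = 0" using z(1) by (auto simp: in_segment orient_segment)
  then have FQ: "mink F Q = 0" using Fiff(4)[OF hz] by (simp add: Q_def)
  have "sinh a * mink F E = 0" using Fiff(4)[OF hpoint_w[of i]] by (simp add: i(4) FQ)
  moreover have "sinh b * mink F E = 0" using Fiff(4)[OF hpoint_t[of i]] by (simp add: i(5) FQ)
  ultimately have FE: "mink F E = 0" using i(3) \<Delta>_pos by auto
  define \<eta> where "\<eta> = mink F G"
  have "sinh c * \<eta> < 0" using Fiff(2)[OF hpoint_w[of j]] right by (simp add: j(4) FQ \<eta>_def)
  then have \<eta>: "\<eta> < 0" using j(1) by (auto simp: mult_less_0_iff)
  have comm: "mink E F = 0" "mink G F = \<eta>" "mink Q F = 0"
    using FE FQ by (simp_all add: mink_commute \<eta>_def)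
  \<comment> \<open>Bessel's inequality for \<open>G\<close> against the orthonormal pair
    \<open>E\<close>, \<open>F\<close>. As \<open>w j\<close> lies off the first height, \<eta> is
    nonzero, which makes \<open>\<kappa>\<^sup>2 < 1\<close> strict.\<close>
  have "mink (G + \<kappa> *\<^sub>R E - \<eta> *\<^sub>R F) (G + \<kappa> *\<^sub>R E - \<eta> *\<^sub>R F) \<ge> 0"
    by (rule mink_orthogonal_nonneg[of Q]) (simp_all add: M comm)
  then have "1 - \<kappa>\<^sup>2 - \<eta>\<^sup>2 \<ge> 0"
    by (simp add: M comm FF FE \<eta>_def[symmetric] power2_eq_square algebra_simps)
  then have "\<kappa>\<^sup>2 < 1" using \<eta> by (smt (verit) zero_less_power2)
  then have \<kappa>: "-1 < \<kappa>" "\<kappa> < 1" by (simp_all add: abs_square_less_1 abs_less_iff)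
  define X where "X = cosh (hdist (w i) (w j))"
  have X: "X = cosh a * cosh c + \<kappa> * (sinh a * sinh c)"
    using hpoint_w by (simp add: X_def cosh_hdist i(4) j(4) M)
  have X1: "X \<ge> 1" unfolding X_def by (rule cosh_real_ge_1)
  have Ni: "mink Ni (lift y) \<ge> 0 \<longleftrightarrow> orient (w (i + h)) (w (Suc (i + h))) y \<ge> 0"
      "mink Ni (lift y) = 0 \<longleftrightarrow> orient (w (i + h)) (w (Suc (i + h))) y = 0"
      "mink Nj (lift y) \<ge> 0 \<longleftrightarrow> orient (w (j + h)) (w (Suc (j + h))) y \<ge> 0"
      "mink Nj (lift y) = 0 \<longleftrightarrow> orient (w (j + h)) (w (Suc (j + h))) y = 0" if "hpoint y" for y
    using mink_normal_lift_iff[OF hpoint_w w_Suc_neq that] by (simp_all only: Ni_def Nj_def)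
  have K1: "\<kappa> * (sinh c * cosh b) \<le> sinh b * cosh c"
    using Ni(1)[OF hpoint_w[of j]] edge_nonneg[of "i + h" j] by (simp add: i(6) j(4) M algebra_simps)
  have K2: "\<kappa> * (sinh a * cosh e) \<le> sinh e * cosh a"
    using Ni(3)[OF hpoint_w[of i]] edge_nonneg[of "j + h" i] by (simp add: j(6) i(4) M algebra_simps)
  define x y where "x = sinh b * sinh e" and "y = cosh b * cosh e"
  define u v where "u = sinh e * cosh b + \<kappa> * (sinh b * cosh e)"
    and "v = sinh b * cosh e + \<kappa> * (sinh e * cosh b)"
  have u: "u \<ge> 0"
    using Ni(3)[OF hpoint_t[of i]] edge_foot_nonneg[of "j + h" i] by (simp add: u_def j(6) i(5) M algebra_simps)
  have v: "v \<ge> 0"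
    using Ni(1)[OF hpoint_t[of j]] edge_foot_nonneg[of "i + h" j] by (simp add: v_def i(6) j(5) M algebra_simps)
  have T: "X * (1 - x - \<kappa> * y) \<le> y - \<kappa> * (1 - x)"
  \<comment> \<open>If the side lines do not meet, the coefficient of \<open>X\<close> is
    nonpositive. \<open>X\<close> may then be lowered to 1, and what remains is
    \<open>cosh (b + e) \<ge> 1\<close>.\<close>
  proof (cases "1 - x - y * \<kappa> > 0")
    case False
    then have "1 - x - \<kappa> * y \<le> 0" by (simp add: mult.commute)
    then have "X * (1 - x - \<kappa> * y) \<le> 1 * (1 - x - \<kappa> * y)"
      using X1 by (intro mult_right_mono_neg) auto
    also have "\<dots> \<le> y - \<kappa> * (1 - x)"
    proof -
      have "(1 - x) * (1 + \<kappa>) \<le> y * (1 + \<kappa>)"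
        using \<kappa> cosh_real_ge_1[of "b + e"] by (intro mult_right_mono) (auto simp: x_def y_def cosh_add)
      then show ?thesis by (simp add: algebra_simps)
    qed
    finally show ?thesis .
  next
    case True
    define \<sigma> where "\<sigma> = 1 - \<kappa>\<^sup>2"
    have \<sigma>: "\<sigma> > 0" using \<open>\<kappa>\<^sup>2 < 1\<close> by (simp add: \<sigma>_def)
    define W where "W = \<sigma> * ((1 + x + y * \<kappa>) * (1 - x - y * \<kappa>))"
    define P where "P = (\<sigma> * y) *\<^sub>R Q - v *\<^sub>R E - u *\<^sub>R G"
    note P = meeting_vector[OF QQ i(7,8) j(7,8), where b = b and e = e, folded \<kappa>_def, folded x_def y_def u_def v_def,
        folded \<sigma>_def, folded P_def W_def, folded i(5,6) j(5,6)]
    have "1 + x + y * \<kappa> > 0"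
      using side_gap_pos(1)[OF i(2) j(2) \<kappa> u[unfolded u_def] v[unfolded v_def]] by (simp add: x_def y_def)
    then have W: "W > 0" using True \<sigma> by (simp add: W_def)
    have y: "y > 0" by (simp add: y_def)
    obtain p where p: "hpoint p" "lift p = (1 / sqrt W) *\<^sub>R P"
    proof (rule timelike_lift[OF _ hz])
      show "mink P P < 0" using W by (simp add: P)
      show "mink P (lift z) < 0" using \<sigma> y by (simp add: P Q_def[symmetric])
    qed (simp add: P)
    have D: "hdist (w i) (w j) \<le> hdist (t i) p + hdist p (t j)"
      unfolding j_def
    proof (rule hdist_le_via_meeting_point[OF m p(1)])
      have "mink Ni (lift p) = 0" "mink Nj (lift p) = 0"
        using P by (simp_all add: p(2) mink_commute)
      then show "orient (w (i + h)) (w (Suc (i + h))) p = 0"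
        "orient (w (Suc (i + h) + m)) (w (Suc (Suc (i + h) + m))) p = 0"
        using Ni[OF p(1)] by (simp_all only: jh)
      \<comment> \<open>\<open>F\<close> is orthogonal to \<open>Q\<close> and \<open>E\<close>, so
        only the \<open>G\<close> component of \<open>P\<close> counts; the signs of
        \<open>u\<close> and \<eta> give the condition \<open>ahead\<close>.\<close>
      have "mink F P = - (u * \<eta>)" by (simp add: P_def FQ FE \<eta>_def)
      also have "\<dots> \<ge> 0" using u \<eta> by (simp add: mult_nonneg_nonpos)
      finally have "mink F (lift p) \<ge> 0" using W by (simp add: p(2))
      then show "orient (w i) (t i) p \<ge> 0" using Fiff(3)[OF p(1)] by simp
    qed
    show ?thesis
      unfolding x_def y_def
    proof (rule meeting_sides_bound[OF i(2) j(2) \<kappa> u[unfolded u_def] v[unfolded v_def]])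
      show "1 - sinh b * sinh e - cosh b * cosh e * \<kappa> > 0" using True by (simp add: x_def y_def)
      show "hdist (t i) p \<ge> 0" "hdist p (t j) \<ge> 0" using hdist_nonneg hpoint_t p by auto
      have "cosh (hdist (t i) p) = \<sigma> * cosh e / sqrt W" "cosh (hdist p (t j)) = \<sigma> * cosh b / sqrt W"
        using P p hpoint_t by (simp_all add: cosh_hdist mink_commute[of "lift (t i)"])
      then show "cosh (hdist (t i) p) = (1 - \<kappa>\<^sup>2) * cosh e / sqrt ((1 - \<kappa>\<^sup>2) *
          ((1 + sinh b * sinh e + cosh b * cosh e * \<kappa>) * (1 - sinh b * sinh e - cosh b * cosh e * \<kappa>)))"
        "cosh (hdist p (t j)) = (1 - \<kappa>\<^sup>2) * cosh b / sqrt ((1 - \<kappa>\<^sup>2) *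
          ((1 + sinh b * sinh e + cosh b * cosh e * \<kappa>) * (1 - sinh b * sinh e - cosh b * cosh e * \<kappa>)))"
        by (simp_all only: \<sigma>_def W_def x_def y_def)
      show "X \<le> cosh (hdist (t i) p + hdist p (t j))"
        unfolding X_def using D hdist_nonneg hpoint_w by (intro cosh_real_nonneg_le_iff[THEN iffD2]) (auto intro: order_trans)
    qed
  qed
  show ?thesis
    using extremal_bound[OF i(1,2) j(1,2) i(3) j(3) \<Delta>_pos \<kappa> X X1 K1 K2 T[unfolded x_def y_def]]
    by (simp add: X_def j_def)
qed

lemma chord_bound:
  assumes "i < n" "j < n"
  shows "3 * (cosh (hdist (w i) (w j)))\<^sup>2 < (cosh \<Delta>)\<^sup>2 * ((cosh \<Delta>)\<^sup>2 + 2)"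
proof -
  have *: "3 * (cosh (hdist (w i) (w j)))\<^sup>2 < (cosh \<Delta>)\<^sup>2 * ((cosh \<Delta>)\<^sup>2 + 2)" if "i < j" "j < n" for i j
  proof (cases "j - i \<le> h")
    case True
    then show ?thesis using short_chord_bound[of "j - i - 1" i] that by simp
  next
    case False
    \<comment> \<open>The complementary arc, from \<open>j\<close> on to \<open>i + n\<close>, has
      \<open>n - (j - i)\<close> edges, at most \<open>h\<close> because
      \<open>n = 2 * h + 1\<close>.\<close>
    define m where "m = n - (j - i) - 1"
    have "Suc m \<le> h" using False that by (simp add: m_def n_eq)
    moreover have "j + Suc m = i + n" using that by (simp add: m_def)
    ultimately show ?thesis
      using short_chord_bound[of m j] by (simp add: periodic hdist_commute)
  qed
  have C: "cosh \<Delta> > 1" using \<Delta>_pos cosh_real_nonneg_less_iff[of 0 \<Delta>] by simp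
  then have "(cosh \<Delta>)\<^sup>2 > 1" by (simp add: one_less_power)
  then have "1 * 3 < (cosh \<Delta>)\<^sup>2 * ((cosh \<Delta>)\<^sup>2 + 2)" by (intro mult_strict_mono) auto
  moreover have "hdist (w i) (w i) = 0" using cosh_hdist[of "w i" "w i"] hpoint_w mink_lift_self hdist_nonneg
    by (simp add: hdist_lift)
  ultimately show ?thesis
    using *[of i j] *[of j i] assms by (cases i j rule: linorder_cases) (auto simp: hdist_commute)
qed

end

section \<open>Diameter of ordinary reduced polygons\<close>

text \<open>On a segment the coefficients of the lifted endpoints add up to at most 1, because the
  product of two lifts is at most -1. The cosh of the distance from \<open>p\<close> is therefore at
  most the larger endpoint value.\<close>

lemma convex_hyperbolic_ball:
  assumes p: "hpoint p" and r: "r \<ge> 0"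
  shows "convex {x. hpoint x \<and> hdist p x \<le> r}"
  unfolding convex_contains_segment
proof (intro ballI subsetI)
  fix x y z
  assume xy: "x \<in> {x. hpoint x \<and> hdist p x \<le> r}" "y \<in> {x. hpoint x \<and> hdist p x \<le> r}"
    and z: "z \<in> closed_segment x y"
  then have h: "hpoint x" "hpoint y" "hpoint z" using hpoint_segment by auto
  obtain \<alpha> \<beta> where ab: "\<alpha> \<ge> 0" "\<beta> \<ge> 0" "lift z = \<alpha> *\<^sub>R lift x + \<beta> *\<^sub>R lift y"
    using lift_in_segment[OF h(1,2) z] by blast
  have "1 = \<alpha>\<^sup>2 + \<beta>\<^sup>2 + 2 * (\<alpha> * \<beta>) * cosh (hdist x y)"
    using mink_lift_self[OF h(3)] mink_lift_self[OF h(1)] mink_lift_self[OF h(2)] cosh_hdist[OF h(1,2)]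
    by (simp add: ab mink_commute[of "lift y" "lift x"] power2_eq_square algebra_simps)
  moreover have "2 * (\<alpha> * \<beta>) * cosh (hdist x y) \<ge> 2 * (\<alpha> * \<beta>) * 1"
    using ab by (intro mult_left_mono cosh_real_ge_1) auto
  ultimately have "(\<alpha> + \<beta>)\<^sup>2 \<le> 1" by (simp add: power2_sum)
  then have sum: "\<alpha> + \<beta> \<le> 1" using ab by (simp add: abs_square_le_1)
  have "cosh (hdist p x) \<le> cosh r" "cosh (hdist p y) \<le> cosh r"
    using xy p h hdist_nonneg r by (auto simp: cosh_real_nonneg_le_iff)
  then have "\<alpha> * cosh (hdist p x) + \<beta> * cosh (hdist p y) \<le> \<alpha> * cosh r + \<beta> * cosh r"
    using ab by (intro add_mono mult_left_mono)
  also have "\<dots> \<le> 1 * cosh r"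
    using sum by (subst distrib_right[symmetric]) (intro mult_right_mono, auto)
  also have "\<alpha> * cosh (hdist p x) + \<beta> * cosh (hdist p y) = cosh (hdist p z)"
    using p h by (simp add: cosh_hdist ab)
  finally have "hdist p z \<le> r"
    using p h hdist_nonneg r by (simp add: cosh_real_nonneg_le_iff)
  with h show "z \<in> {x. hpoint x \<and> hdist p x \<le> r}" by simp
qed

text \<open>Convexity of balls is used twice: balls around the points of \<open>S\<close> contain
  the hull and so \<open>q\<close>; then the ball around \<open>q\<close> contains \<open>S\<close>
  and so the hull.\<close>

lemma hdist_convex_hull_le:
  assumes S: "\<And>x. x \<in> S \<Longrightarrow> hpoint x" and le: "\<And>x y. x \<in> S \<Longrightarrow> y \<in> S \<Longrightarrow> hdist x y \<le> r"
    and p: "p \<in> convex hull S" and q: "q \<in> convex hull S"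
  shows "hdist p q \<le> r"
proof -
  obtain s where s: "s \<in> S" using p by fastforce
  have r: "r \<ge> 0" using le[OF s s] hdist_nonneg[OF S[OF s] S[OF s]] by simp
  have hull: "convex hull S \<subseteq> {y. hpoint y \<and> hdist x y \<le> r}" if "x \<in> S" for x
    using that S le by (intro hull_minimal convex_hyperbolic_ball r) auto
  then have "hpoint q" using q s by auto
  moreover have "hdist q x \<le> r" if "x \<in> S" for x
    using hull[OF that] q hdist_commute[of q x] by auto
  ultimately have "convex hull S \<subseteq> {y. hpoint y \<and> hdist q y \<le> r}"
    using S by (intro hull_minimal convex_hyperbolic_ball r) auto
  then show ?thesis using p hdist_commute[of p q] by auto
qed

lemma ordinary_reduced_star_polygon:
  assumes "ordinary_reduced_polygon n v"
  obtains t h where "star_polygon (\<lambda>k. v (k mod n)) n t h (thickness (convex hull (v ` {..<n})))"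
proof -
  define \<Delta> where "\<Delta> = thickness (convex hull (v ` {..<n}))"
  define w where "w k = v (k mod n)" for k
  define h where "h = (n - 1) div 2"
  have n3: "n \<ge> 3" and odd: "odd n" and hp: "\<And>i. i < n \<Longrightarrow> hpoint (v i)"
    and edge: "\<And>i j. i < n \<Longrightarrow> j < n \<Longrightarrow> j \<noteq> i \<Longrightarrow> j \<noteq> (i + 1) mod n
      \<Longrightarrow> cross2 (v ((i + 1) mod n) - v i) (v j - v i) > 0"
    using assms by (auto simp: ordinary_reduced_polygon_def convex_polygon_def)
  have nh: "n = Suc (2 * h)" "(n + 1) div 2 = Suc h" using odd n3 by (auto simp: h_def elim!: oddE)
  interpret convex_cycle w n
  proof
    show "w (k + n) = w k" for k by (simp add: w_def)
    show "hpoint (w k)" for k using hp n3 by (simp add: w_def)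
    show "orient (w k) (w (Suc k)) (w (k + m)) > 0" if "2 \<le> m" "m < n" for k m
    proof -
      define i where "i = k mod n"
      have i: "i < n" using n3 by (simp add: i_def)
      have 1: "(k + m) mod n = (i + m) mod n" "Suc k mod n = (i + 1) mod n"
        unfolding i_def by (simp_all add: mod_add_left_eq mod_Suc_eq)
      have "(i + m) mod n = (if i + m < n then i + m else i + m - n)"
        "(i + 1) mod n = (if i + 1 < n then i + 1 else 0)"
        using i that by (auto simp: mod_if)
      then have "(i + m) mod n \<noteq> i" "(i + m) mod n \<noteq> (i + 1) mod n"
        using i that by (auto split: if_splits)
      then have "cross2 (v ((i + 1) mod n) - v i) (v ((i + m) mod n) - v i) > 0"
        using edge i n3 by simp
      moreover have "w k = v i" "w (Suc k) = v ((i + 1) mod n)" "w (k + m) = v ((i + m) mod n)"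
        unfolding w_def 1 i_def by (rule refl)+
      ultimately show ?thesis by (simp only: orient_def)
    qed
  qed (use n3 in simp)
  have "\<exists>q. is_foot (v i) (hline_through (v ((i + h) mod n)) (v ((i + Suc h) mod n))) q
      \<and> q \<in> open_segment (v ((i + h) mod n)) (v ((i + Suc h) mod n)) \<and> hdist (v i) q = \<Delta>" if "i < n" for i
  proof -
    have "\<forall>i<n. let a = v ((i + (n - 1) div 2) mod n); b = v ((i + (n + 1) div 2) mod n) in
        (\<exists>q. is_foot (v i) (hline_through a b) q \<and> q \<in> open_segment a b
             \<and> hdist (v i) q = thickness (convex hull (v ` {..<n})))"
      using assms unfolding ordinary_reduced_polygon_def by (elim conjE)
    from this[unfolded Let_def nh(2), folded h_def \<Delta>_def, rule_format, OF that] show ?thesis .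
  qed
  then obtain q where q: "\<And>i. i < n \<Longrightarrow> is_foot (v i) (hline_through (v ((i + h) mod n)) (v ((i + Suc h) mod n))) (q i)"
    "\<And>i. i < n \<Longrightarrow> q i \<in> open_segment (v ((i + h) mod n)) (v ((i + Suc h) mod n))"
    "\<And>i. i < n \<Longrightarrow> hdist (v i) (q i) = \<Delta>"
    by metis
  define t where "t k = q (k mod n)" for k
  have idx: "v ((k mod n + h) mod n) = w (k + h)" "v ((k mod n + Suc h) mod n) = w (Suc (k + h))" for k
    by (simp_all only: w_def mod_add_left_eq add_Suc_right[symmetric])
  have t: "is_foot (w k) (hline_through (w (k + h)) (w (Suc (k + h)))) (t k)"
    "t k \<in> open_segment (w (k + h)) (w (Suc (k + h)))" "hdist (w k) (t k) = \<Delta>" for k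
    using q[of "k mod n"] n3 by (simp_all only: idx) (simp_all add: w_def t_def)
  have decomp: "lift (w k) = cosh \<Delta> *\<^sub>R lift (t k) + sinh \<Delta> *\<^sub>R normal (w (k + h)) (w (Suc (k + h)))"
    "\<Delta> > 0" for k
  proof -
    \<comment> \<open>Index \<open>k + n\<close> moves the apex \<open>w k\<close> past its opposite
      side, so that the three indices increase within one period.\<close>
    have "orient (w (k + h)) (w (Suc (k + h))) (w (k + n)) > 0"
      using n3 nh by (intro orient_pos) auto
    then have pos: "orient (w (k + h)) (w (Suc (k + h))) (w k) > 0" by (simp only: periodic)
    then have neq: "w (k + h) \<noteq> w (Suc (k + h))" by auto
    show "lift (w k) = cosh \<Delta> *\<^sub>R lift (t k) + sinh \<Delta> *\<^sub>R normal (w (k + h)) (w (Suc (k + h)))"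
      "\<Delta> > 0"
      using foot_decomposition[OF hpoint_w hpoint_w neq pos t(1)] by (simp_all only: t(3))
  qed
  have "t (k + n) = t k" for k by (simp add: t_def)
  then have "star_polygon w n t h \<Delta>"
    using nh(1) t(2) decomp by unfold_locales
  then have "star_polygon (\<lambda>k. v (k mod n)) n t h (thickness (convex hull (v ` {..<n})))"
    unfolding w_def[abs_def] \<Delta>_def .
  then show ?thesis by (rule that)
qed

theorem theorem3:
  fixes n :: nat and v :: "nat \<Rightarrow> real^2"
  assumes "ordinary_reduced_polygon n v"
  shows "hdiam (convex hull (v ` {..<n})) <
    arcosh (cosh (thickness (convex hull (v ` {..<n})))
      * sqrt (1 + (sinh (thickness (convex hull (v ` {..<n}))))^2 / 3))"
proof -
  define V where "V = v ` {..<n}"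
  define \<Delta> where "\<Delta> = thickness (convex hull V)"
  define R where "R = arcosh (cosh \<Delta> * sqrt (1 + (sinh \<Delta>)\<^sup>2 / 3))"
  obtain t h where "star_polygon (\<lambda>k. v (k mod n)) n t h \<Delta>"
    using ordinary_reduced_star_polygon[OF assms] by (auto simp: \<Delta>_def V_def)
  then interpret star_polygon "\<lambda>k. v (k mod n)" n t h \<Delta> .
  have V: "hpoint x" if x: "x \<in> V" for x
  proof -
    obtain i where "i < n" "x = v i" using x by (auto simp: V_def)
    then show ?thesis using hpoint_w[of i] by simp
  qed
  have less: "hdist x y < R" if xy: "x \<in> V" "y \<in> V" for x y
  proof -
    obtain i j where ij: "i < n" "j < n" "x = v i" "y = v j" using xy by (auto simp: V_def)
    define X where "X = cosh (hdist x y)"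
    have "3 * X\<^sup>2 < (cosh \<Delta>)\<^sup>2 * ((cosh \<Delta>)\<^sup>2 + 2)"
      using chord_bound[OF ij(1,2)] ij by (simp add: X_def)
    also have "\<dots> = 3 * (cosh \<Delta> * sqrt (1 + (sinh \<Delta>)\<^sup>2 / 3))\<^sup>2"
    proof -
      have sq: "(sqrt (1 + (sinh \<Delta>)\<^sup>2 / 3))\<^sup>2 = 1 + (sinh \<Delta>)\<^sup>2 / 3"
        by (intro real_sqrt_pow2 add_nonneg_nonneg) auto
      show ?thesis unfolding power_mult_distrib sq cosh_square_eq by (simp add: algebra_simps)
    qed
    finally have "X\<^sup>2 < (cosh \<Delta> * sqrt (1 + (sinh \<Delta>)\<^sup>2 / 3))\<^sup>2" by simp
    then have "X < cosh \<Delta> * sqrt (1 + (sinh \<Delta>)\<^sup>2 / 3)"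
      by (rule power2_less_imp_less) simp
    then have "arcosh X < R"
      unfolding R_def X_def by (intro arcosh_real_strict_mono cosh_real_ge_1)
    then show ?thesis using hdist_nonneg[OF V[OF xy(1)] V[OF xy(2)]] by (simp add: X_def arcosh_cosh_real)
  qed
  \<comment> \<open>The supremum over the hull is at most a maximum over finitely many vertex pairs,
    so the strict bound for each pair survives.\<close>
  define D where "D = (\<lambda>(x, y). hdist x y) ` (V \<times> V)"
  have "v 0 \<in> V" using n_ge_3 by (simp add: V_def)
  then have D: "finite D" "D \<noteq> {}" and ne: "convex hull V \<noteq> {}"
    by (auto simp: D_def V_def)
  have le: "hdist x y \<le> Max D" if "x \<in> V" "y \<in> V" for x y
    using that by (intro Max_ge D) (force simp: D_def)
  have "hdiam (convex hull V) \<le> Max D"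
    unfolding hdiam_def
  proof (rule cSup_least)
    show "{hdist p q |p q. p \<in> convex hull V \<and> q \<in> convex hull V} \<noteq> {}" using ne by blast
    fix d
    assume "d \<in> {hdist p q |p q. p \<in> convex hull V \<and> q \<in> convex hull V}"
    then obtain p q where pq: "d = hdist p q" "p \<in> convex hull V" "q \<in> convex hull V" by blast
    show "d \<le> Max D"
      unfolding pq(1) by (rule hdist_convex_hull_le[OF V le pq(2,3)])
  qed
  also have "Max D < R"
    unfolding Max_less_iff[OF D] using less by (auto simp: D_def)
  finally show ?thesis by (simp add: R_def \<Delta>_def V_def)
qed

end
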